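(* Let $N\ge 1$ and let $(\Theta^0,\mathcal V,\Phi)$ and $(\tilde\Theta^0,\tilde{\mathcal V},\tilde\Phi)$ be two triples of initial data, natural frequencies and communication matrices (both matrices symmetric with positive entries). Suppose there exist $b_\Phi\ge a_\Phi>0$, $-L<a_G<b_G<L$ and $\theta_*\in(0,\pi/2)$ such that $$\max\{\mathcal D(\Theta^0),\mathcal D(\tilde\Theta^0)\}\le\theta_*,\qquad a_\Phi\le\phi_{\alpha\beta},\tilde\phi_{\alpha\beta}\le b_\Phi\quad\forall\,\alpha,\beta\in[N],$$ $$\kappa>\max\Big\{\frac{\mathcal D(\mathcal V)}{m_\Phi\sin\theta_*},\ \frac{\mathcal D(\tilde{\mathcal V})}{m_{\tilde\Phi}\sin\theta_*},\ \frac{M_{\mathcal Q^{-1}[F]}}{\max\{m_\Phi,m_{\tilde\Phi}\}\,m_{G'}^2\cos\theta_*}\Big\},$$ $$F(a_G)+\kappa b_\Phi\le\nu_\alpha,\tilde\nu_\alpha\le F(b_G)-\kappa b_\Phi\quad\forall\,\alpha\in[N],\qquad \sum_{\alpha=1}^N\nu_\alpha=\sum_{\alpha=1}^N\tilde\nu_\alpha .$$ Let $\Theta=\Theta(t)$ and $\tilde\Theta=\tilde\Theta(t)$ be two global solutions of the generalized Kuramoto model associated with $(\Theta^0,\mathcal V,\Phi)$ and $(\tilde\Theta^0,\tilde{\mathcal V},\tilde\Phi)$, respectively. Then there exists a positive constant $\Lambda_3=\Lambda_3(\kappa,F,a_\Phi,b_\Phi,a_G,b_G,\theta_* )$, depending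 only on the listed quantities, such that for every $p\in[1,\infty]$, $$\sup_{0\le t<\infty}\|\Theta(t)-\tilde\Theta(t)\|_p\le\Lambda_3\Big(\|\Theta^0-\tilde\Theta^0\|_p+\|\mathcal V-\tilde{\mathcal V}\|_p+\frac{\|\Phi-\tilde\Phi\|_p}{N^{1/p}}\Big).$$
   Context: Let $L\in(0,\infty]$ and let $F:(-L,L)\to\mathbb R$ be a $C^2$ function with $F(-\theta)=-F(\theta)$ and $F'(\theta)>0$ for all $\theta\in(-L,L)$; $G=F^{-1}$ is its inverse. Write $[N]=\{1,\dots,N\}$. Generalized Kuramoto (GK) model: given $\kappa>0$, initial phases $\Theta^0=(\theta^0_1,\dots,\theta^0_N)\in\mathbb R^N$, natural frequencies $\mathcal V=(\nu_1,\dots,\nu_N)\in\mathbb R^N$ and communication matrix $\Phi=(\phi_{\alpha\beta})$ with $\phi_{\alpha\beta}=\phi_{\beta\alpha}>0$, a solution $\Theta(t)=(\theta_1(t),\dots,\theta_N(t))\in\mathbb R^N$ satisfies $$F(\dot\theta_\alpha)=\nu_\alpha+\frac{\kappa}{N}\sum_{\beta=1}^N\phi_{\alpha\beta}\sin(\theta_\beta-\theta_\alpha),\quad t>0,\qquad \theta_\alpha(0)=\theta_\alpha^0,\quad\alpha\in[N].$$ Notation: $\mathcal D(\mathbf x)=\max_\alpha x_\alpha-\min_\alpha x_\alpha$ for a vector $\mathbf x$; $m_\Phi=\min_{\alpha,\beta}\phi_{\alpha\beta}$; $m_{G'}=\min_{F(a_G)\le y\le F(b_G)}G'(y)$; $M_{\mathcal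 Q^{-1}[F]}=\max_{(x,y)\in[a_G,b_G]^2}\mathcal Q^{-1}[F](x,y)$, where $\mathcal Q^{-1}[F](x,y)=\frac{x-y}{F(x)-F(y)}$ if $x\ne y$ and $\mathcal Q^{-1}[F](x,x)=\frac1{F'(x)}$. $\|\mathbf x\|_p$ is the usual $\ell_p$ norm of a vector; for a matrix $A=(a_{\alpha\beta})$, $\|A\|_p=\big(\sum_{\alpha,\beta}|a_{\alpha\beta}|^p\big)^{1/p}$ for $p<\infty$ and $\|A\|_\infty=\max_{\alpha,\beta}|a_{\alpha\beta}|$. For $p=\infty$, $N^{1/p}=1$. *)

theory Defs
  imports "HOL-Analysis.Analysis"
begin

definition Ginv :: "ereal \<Rightarrow> (real \<Rightarrow> real) \<Rightarrow> real \<Rightarrow> real" where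
  "Ginv L F = the_inv_into (einterval (- L) L) F"

(* The infimum is over the image of a compact interval under a continuous function, and the
   supremum in M_Qinv likewise over a compact square, so both are attained: they are the
   minimum and the maximum. *)
definition m_Gderiv :: "ereal \<Rightarrow> (real \<Rightarrow> real) \<Rightarrow> real \<Rightarrow> real \<Rightarrow> real" where
  "m_Gderiv L F aG bG = (INF y\<in>{F aG..F bG}. deriv (Ginv L F) y)"

definition Qinv :: "(real \<Rightarrow> real) \<Rightarrow> real \<Rightarrow> real \<Rightarrow> real" where
  "Qinv F x y = (if x = y then 1 / deriv F x else (x - y) / (F x - F y))"

definition M_Qinv :: "(real \<Rightarrow> real) \<Rightarrow> real \<Rightarrow> real \<Rightarrow> real" where
  "M_Qinv F aG bG = (SUP (x, y)\<in>{aG..bG} \<times> {aG..bG}. Qinv F x y)"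

(* Vectors in R^N and N x N matrices are functions on nat, restricted to the indices 1, ..., N;
   values at other indices are irrelevant. *)
definition diam :: "nat \<Rightarrow> (nat \<Rightarrow> real) \<Rightarrow> real" where
  "diam N x = (MAX \<alpha>\<in>{1..N}. x \<alpha>) - (MIN \<alpha>\<in>{1..N}. x \<alpha>)"

definition min_entry :: "nat \<Rightarrow> (nat \<Rightarrow> nat \<Rightarrow> real) \<Rightarrow> real" where
  "min_entry N \<phi> = (MIN (\<alpha>, \<beta>)\<in>{1..N} \<times> {1..N}. \<phi> \<alpha> \<beta>)"

definition lp_norm :: "ereal \<Rightarrow> 'i set \<Rightarrow> ('i \<Rightarrow> real) \<Rightarrow> real" where
  "lp_norm p I x =
     (if p = \<infinity> then (MAX i\<in>I. \<bar>x i\<bar>)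
      else (\<Sum>i\<in>I. \<bar>x i\<bar> powr real_of_ereal p) powr (1 / real_of_ereal p))"

definition vec_norm :: "ereal \<Rightarrow> nat \<Rightarrow> (nat \<Rightarrow> real) \<Rightarrow> real" where
  "vec_norm p N x = lp_norm p {1..N} x"

definition mat_norm :: "ereal \<Rightarrow> nat \<Rightarrow> (nat \<Rightarrow> nat \<Rightarrow> real) \<Rightarrow> real" where
  "mat_norm p N A = lp_norm p ({1..N} \<times> {1..N}) (\<lambda>(\<alpha>, \<beta>). A \<alpha> \<beta>)"

definition comm_matrix :: "nat \<Rightarrow> (nat \<Rightarrow> nat \<Rightarrow> real) \<Rightarrow> bool" where
  "comm_matrix N \<phi> \<longleftrightarrow>
     (\<forall>\<alpha>\<in>{1..N}. \<forall>\<beta>\<in>{1..N}. \<phi> \<alpha> \<beta> = \<phi> \<beta> \<alpha> \<and> \<phi> \<alpha> \<beta> > 0)"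

(* The equation is imposed for t > 0 only; continuity on [0, \<infinity>) links it to the initial value.
   Since F is only meaningful on (-L, L), the velocities are required to lie there. *)
definition GK_solution ::
  "ereal \<Rightarrow> (real \<Rightarrow> real) \<Rightarrow> real \<Rightarrow> nat \<Rightarrow> (nat \<Rightarrow> real) \<Rightarrow> (nat \<Rightarrow> real)
     \<Rightarrow> (nat \<Rightarrow> nat \<Rightarrow> real) \<Rightarrow> (real \<Rightarrow> nat \<Rightarrow> real) \<Rightarrow> bool" where
  "GK_solution L F \<kappa> N \<Theta>0 \<nu> \<phi> \<Theta> \<longleftrightarrow>
     (\<forall>\<alpha>\<in>{1..N}.
        \<Theta> 0 \<alpha> = \<Theta>0 \<alpha> \<and>
        continuous_on {0..} (\<lambda>t. \<Theta> t \<alpha>) \<and>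
        (\<forall>t>0. \<exists>\<omega>. ((\<lambda>s. \<Theta> s \<alpha>) has_real_derivative \<omega>) (at t) \<and>
           \<omega> \<in> einterval (- L) L \<and>
           F \<omega> = \<nu> \<alpha> + \<kappa> / real N * (\<Sum>\<beta>=1..N. \<phi> \<alpha> \<beta> * sin (\<Theta> t \<beta> - \<Theta> t \<alpha>))))"

end

theory Submission
  imports Defs
begin

text \<open>
  Write x for the difference of the two phase vectors. Each velocity is the inverse of F at a force,
  and by the mean value theorem a difference of velocities is a slope times a difference of
  forces, while a difference of two sines is a slope, between cos \<theta>s and 1, times a difference of
  arguments. Hence x solves a linear consensus equation
  x'_\<alpha> = c_\<alpha>(t) * (f_\<alpha>(t) + \<Sum>\<beta>. W_\<alpha>\<beta>(t) * (x_\<beta> - x_\<alpha>)),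
  with symmetric weights W of order 1/N bounded below, and with a source f that has zero sum and is
  controlled by the differences of the natural frequencies and of the communication matrices.

  For constant c such an equation is stable in every p-norm: each short Euler step is a convex
  combination of a doubly stochastic averaging and the mean, doubly stochastic matrices contract every p-norm,
  and the mean of x is conserved. The time-dependent c spoils the conservation of the mean, but only
  by an integrable amount. Indeed the forces y_\<alpha> = F(velocity_\<alpha>) of a single solution themselves obey a
  consensus equation with conserved mean, the mean of the natural frequencies, so they converge to
  it exponentially (GK_flow.velocity_synchronization). As both solutions have the same mean natural
  frequency, all velocities converge to one common value and all c_\<alpha> converge exponentially to one
  common constant. A Gronwall argument for the larger of the norm of x and the shifted norm of its
  mean then gives a bound that is uniform in time (perturbed_consensus_bound). Every rate that occurs
  is independent of N and p.

  The lower bound cos \<theta>s on the sine slopes needs the phases to stay within \<theta>s of each other for all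
  time (phase_diameter_invariant): at an extremal pair the coupling beats the spread of the natural
  frequencies, so the gap of the pair closes.

  The p-norms are not differentiable for p = 1 and p = \<infinity>. All estimates are therefore phrased as
  one-sided growth bounds for short time steps, which treats all p at once and uses only
  convexity of the norm (dini_gronwall).
\<close>

section \<open>Norms and doubly stochastic averaging\<close>

lemma convex_on_powr_nonneg:
  fixes q :: real
  assumes "1 \<le> q"
  shows "convex_on {0..} (\<lambda>x. x powr q)"
proof (rule convex_onI)
  fix t x y :: real
  assume t: "0 < t" "t < 1" and xy: "x \<in> {0..}" "y \<in> {0..}"
  have shrink: "(u * v) powr q \<le> u * v powr q" if "0 < u" "u < 1" "0 \<le> v" for u v :: real
  proof -
    have "u powr q \<le> u powr 1"
      using that assms by (intro powr_mono') auto
    then show ?thesis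
      using that by (simp add: powr_mult mult_right_mono)
  qed
  consider "x = 0" | "y = 0" | "0 < x" "0 < y"
    using xy by force
  then show "((1 - t) *\<^sub>R x + t *\<^sub>R y) powr q \<le> (1 - t) * x powr q + t * y powr q"
  proof cases
    case 3
    then show ?thesis
      using convex_onD[OF powr_convex[OF assms], of t x y] t by simp
  qed (use t xy shrink[of t y] shrink[of "1 - t" x] assms in auto)
qed simp

text \<open>
  The consensus estimates need of the p-norms only monotonicity, homogeneity, the triangle inequality
  and contraction under doubly stochastic matrices. For finite p, comparing a norm with a constant is
  comparing sums of p-th powers, so these properties come from convexity of the p-th power; for
  p = \<infinity> they are checked entrywise.
\<close>

lemma vec_norm_infinity_le_iff:
  assumes "1 \<le> N"
  shows "vec_norm \<infinity> N x \<le> c \<longleftrightarrow> (\<forall>\<alpha>\<in>{1..N}. \<bar>x \<alpha>\<bar> \<le> c)"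
  using assms by (simp add: vec_norm_def lp_norm_def)

lemma vec_norm_powr:
  assumes "1 \<le> q"
  shows "vec_norm (ereal q) N x powr q = (\<Sum>\<alpha>=1..N. \<bar>x \<alpha>\<bar> powr q)"
proof -
  have "0 \<le> (\<Sum>\<alpha>=1..N. \<bar>x \<alpha>\<bar> powr q)"
    by (intro sum_nonneg) auto
  then show ?thesis
    using assms by (simp add: vec_norm_def lp_norm_def powr_powr)
qed

lemma vec_norm_nonneg:
  assumes "1 \<le> N"
  shows "0 \<le> vec_norm p N x"
proof (cases "p = \<infinity>")
  case True
  have "\<bar>x 1\<bar> \<le> vec_norm p N x"
    using assms True by (auto simp: vec_norm_def lp_norm_def intro!: Max_ge)
  then show ?thesis by linarith
qed (auto simp: vec_norm_def lp_norm_def)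

lemma vec_norm_le_iff:
  assumes "1 \<le> q" "1 \<le> N" "0 \<le> c"
  shows "vec_norm (ereal q) N x \<le> c \<longleftrightarrow> (\<Sum>\<alpha>=1..N. \<bar>x \<alpha>\<bar> powr q) \<le> c powr q"
proof -
  have "vec_norm (ereal q) N x powr q \<le> c powr q \<longleftrightarrow> vec_norm (ereal q) N x \<le> c"
    using assms vec_norm_nonneg[OF assms(2), of "ereal q" x]
    by (smt (verit) powr_less_mono2 powr_mono2)
  then show ?thesis
    using vec_norm_powr[OF assms(1)] by simp
qed

lemma vec_norm_mono:
  assumes "1 \<le> p" "1 \<le> N" and le: "\<And>\<alpha>. \<alpha> \<in> {1..N} \<Longrightarrow> \<bar>x \<alpha>\<bar> \<le> \<bar>y \<alpha>\<bar>"
  shows "vec_norm p N x \<le> vec_norm p N y"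
proof (cases p)
  case (real q)
  then have q: "1 \<le> q" using assms by simp
  have "(\<Sum>\<alpha>=1..N. \<bar>x \<alpha>\<bar> powr q) \<le> (\<Sum>\<alpha>=1..N. \<bar>y \<alpha>\<bar> powr q)"
    using le q by (intro sum_mono powr_mono2) auto
  then show ?thesis
    using real vec_norm_le_iff[OF q assms(2) vec_norm_nonneg[OF assms(2)]] vec_norm_powr[OF q]
    by simp
next
  case PInf
  have "\<bar>y \<alpha>\<bar> \<le> vec_norm p N y" if "\<alpha> \<in> {1..N}" for \<alpha>
    using PInf that vec_norm_infinity_le_iff[OF assms(2), of y "vec_norm p N y"] by blast
  then show ?thesis
    using PInf vec_norm_infinity_le_iff[OF assms(2)] order_trans[OF le] by blast
qed (use assms in auto)

lemma vec_norm_cong_abs: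
  assumes "1 \<le> p" "1 \<le> N" "\<And>\<alpha>. \<alpha> \<in> {1..N} \<Longrightarrow> \<bar>x \<alpha>\<bar> = \<bar>y \<alpha>\<bar>"
  shows "vec_norm p N x = vec_norm p N y"
  using assms by (intro antisym vec_norm_mono) auto

lemma vec_norm_scale:
  assumes "1 \<le> p" "1 \<le> N"
  shows "vec_norm p N (\<lambda>\<alpha>. c * x \<alpha>) \<le> \<bar>c\<bar> * vec_norm p N x"
proof (cases p)
  case (real q)
  then have q: "1 \<le> q" using assms by simp
  have "(\<Sum>\<alpha>=1..N. \<bar>c * x \<alpha>\<bar> powr q) = (\<bar>c\<bar> * vec_norm p N x) powr q"
    using vec_norm_nonneg[OF assms(2), of p x] real
    by (simp add: abs_mult powr_mult vec_norm_powr[OF q] sum_distrib_left)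
  then show ?thesis
    using real vec_norm_le_iff[OF q assms(2), of "\<bar>c\<bar> * vec_norm p N x"]
      vec_norm_nonneg[OF assms(2), of p x] by simp
next
  case PInf
  then show ?thesis
    using vec_norm_infinity_le_iff[OF assms(2), of x "vec_norm p N x"]
    by (auto simp: vec_norm_infinity_le_iff[OF assms(2)] abs_mult intro!: mult_left_mono)
qed (use assms in auto)

text \<open>
  For finite p this is convexity of the unit ball: x + y is (a + b) times a convex combination of x / a
  and y / b, where a and b are slightly larger than the norms of x and y. The slack avoids a division
  by zero.
\<close>

lemma vec_norm_triangle:
  assumes "1 \<le> p" "1 \<le> N"
  shows "vec_norm p N (\<lambda>\<alpha>. x \<alpha> + y \<alpha>) \<le> vec_norm p N x + vec_norm p N y"
proof (cases p)
  case (real q)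
  then have q: "1 \<le> q" using assms by simp
  show ?thesis
  proof (rule field_le_epsilon)
    fix e :: real assume e: "0 < e"
    define a where "a = vec_norm p N x + e / 2"
    define b where "b = vec_norm p N y + e / 2"
    have ab: "0 < a" "0 < b"
      using e vec_norm_nonneg[OF assms(2), of p] by (auto simp: a_def b_def intro: add_nonneg_pos)
    have xa: "(\<Sum>\<alpha>=1..N. \<bar>x \<alpha>\<bar> powr q) \<le> a powr q"
      and yb: "(\<Sum>\<alpha>=1..N. \<bar>y \<alpha>\<bar> powr q) \<le> b powr q"
      using vec_norm_le_iff[OF q assms(2), of a x] vec_norm_le_iff[OF q assms(2), of b y] ab e real
      by (auto simp: a_def b_def)
    have pt: "\<bar>x \<alpha> + y \<alpha>\<bar> powr q \<le> (a + b) powr q *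
        (a / (a + b) * (\<bar>x \<alpha>\<bar> powr q / a powr q) + b / (a + b) * (\<bar>y \<alpha>\<bar> powr q / b powr q))"
      for \<alpha>
    proof -
      have eq: "1 - b / (a + b) = a / (a + b)" using ab by (simp add: field_simps)
      have "\<bar>x \<alpha> + y \<alpha>\<bar> \<le> (a + b) * (a / (a + b) * (\<bar>x \<alpha>\<bar> / a) + b / (a + b) * (\<bar>y \<alpha>\<bar> / b))"
        using ab by (simp add: distrib_left abs_triangle_ineq)
      then have "\<bar>x \<alpha> + y \<alpha>\<bar> powr q
          \<le> ((a + b) * (a / (a + b) * (\<bar>x \<alpha>\<bar> / a) + b / (a + b) * (\<bar>y \<alpha>\<bar> / b))) powr q"
        using q by (intro powr_mono2) auto
      also have "\<dots> = (a + b) powr q * (a / (a + b) * (\<bar>x \<alpha>\<bar> / a) + b / (a + b) * (\<bar>y \<alpha>\<bar> / b)) powr q"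
        by (rule powr_mult)
      also have "\<dots> \<le> (a + b) powr q *
          (a / (a + b) * (\<bar>x \<alpha>\<bar> / a) powr q + b / (a + b) * (\<bar>y \<alpha>\<bar> / b) powr q)"
        using convex_onD[OF convex_on_powr_nonneg[OF q], of "b / (a + b)" "\<bar>x \<alpha>\<bar> / a" "\<bar>y \<alpha>\<bar> / b"]
          ab by (intro mult_left_mono) (auto simp: eq)
      finally show ?thesis using ab by (simp add: powr_divide)
    qed
    have "(\<Sum>\<alpha>=1..N. \<bar>x \<alpha> + y \<alpha>\<bar> powr q) \<le> (\<Sum>\<alpha>=1..N. (a + b) powr q *
        (a / (a + b) * (\<bar>x \<alpha>\<bar> powr q / a powr q) + b / (a + b) * (\<bar>y \<alpha>\<bar> powr q / b powr q)))"
      by (intro sum_mono pt)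
    also have "\<dots> = (a + b) powr q * (a / (a + b) * ((\<Sum>\<alpha>=1..N. \<bar>x \<alpha>\<bar> powr q) / a powr q)
        + b / (a + b) * ((\<Sum>\<alpha>=1..N. \<bar>y \<alpha>\<bar> powr q) / b powr q))"
      by (simp only: sum_distrib_left sum.distrib sum_divide_distrib distrib_left)
    also have "\<dots> \<le> (a + b) powr q * (a / (a + b) * 1 + b / (a + b) * 1)"
      using xa yb ab by (intro mult_left_mono add_mono) (auto simp: divide_le_eq_1)
    also have "\<dots> = (a + b) powr q"
      using ab by (simp flip: add_divide_distrib)
    finally show "vec_norm p N (\<lambda>\<alpha>. x \<alpha> + y \<alpha>) \<le> vec_norm p N x + vec_norm p N y + e"
      using vec_norm_le_iff[OF q assms(2), of "a + b" "\<lambda>\<alpha>. x \<alpha> + y \<alpha>"] ab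
      by (simp add: real a_def b_def algebra_simps)
  qed
next
  case PInf
  then show ?thesis
    using vec_norm_infinity_le_iff[OF assms(2), of x "vec_norm p N x"]
      vec_norm_infinity_le_iff[OF assms(2), of y "vec_norm p N y"]
    by (auto simp: vec_norm_infinity_le_iff[OF assms(2)] intro: order_trans[OF abs_triangle_ineq] add_mono)
qed (use assms in auto)

text \<open>
  For finite p, Jensen's inequality in each row bounds the p-th powers by averages of p-th powers, and
  the column sums collect these to the original total. For p = \<infinity>
  each entry of the image is an average of entries of x.
\<close>

lemma vec_norm_stochastic:
  assumes "1 \<le> p" "1 \<le> N"
    and nonneg: "\<And>\<alpha> \<beta>. \<alpha> \<in> {1..N} \<Longrightarrow> \<beta> \<in> {1..N} \<Longrightarrow> 0 \<le> P \<alpha> \<beta>"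
    and rows: "\<And>\<alpha>. \<alpha> \<in> {1..N} \<Longrightarrow> (\<Sum>\<beta>=1..N. P \<alpha> \<beta>) = 1"
    and columns: "\<And>\<beta>. \<beta> \<in> {1..N} \<Longrightarrow> (\<Sum>\<alpha>=1..N. P \<alpha> \<beta>) = 1"
  shows "vec_norm p N (\<lambda>\<alpha>. \<Sum>\<beta>=1..N. P \<alpha> \<beta> * x \<beta>) \<le> vec_norm p N x"
proof (cases p)
  case (real q)
  then have q: "1 \<le> q" using assms by simp
  have "(\<Sum>\<alpha>=1..N. \<bar>\<Sum>\<beta>=1..N. P \<alpha> \<beta> * x \<beta>\<bar> powr q)
      \<le> (\<Sum>\<alpha>=1..N. \<Sum>\<beta>=1..N. P \<alpha> \<beta> * \<bar>x \<beta>\<bar> powr q)"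
  proof (rule sum_mono)
    fix \<alpha> assume \<alpha>: "\<alpha> \<in> {1..N}"
    have "\<bar>\<Sum>\<beta>=1..N. P \<alpha> \<beta> * x \<beta>\<bar> \<le> (\<Sum>\<beta>=1..N. P \<alpha> \<beta> * \<bar>x \<beta>\<bar>)"
      by (rule order_trans[OF sum_abs]) (use nonneg \<alpha> in \<open>auto simp: abs_mult\<close>)
    then have "\<bar>\<Sum>\<beta>=1..N. P \<alpha> \<beta> * x \<beta>\<bar> powr q \<le> (\<Sum>\<beta>=1..N. P \<alpha> \<beta> * \<bar>x \<beta>\<bar>) powr q"
      using q by (intro powr_mono2) auto
    also have "\<dots> \<le> (\<Sum>\<beta>=1..N. P \<alpha> \<beta> * \<bar>x \<beta>\<bar> powr q)"
      using convex_on_sum[OF _ _ convex_on_powr_nonneg[OF q], of "{1..N}" "P \<alpha>" "\<lambda>\<beta>. \<bar>x \<beta>\<bar>"]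
        assms(2) nonneg rows \<alpha> by auto
    finally show "\<bar>\<Sum>\<beta>=1..N. P \<alpha> \<beta> * x \<beta>\<bar> powr q \<le> (\<Sum>\<beta>=1..N. P \<alpha> \<beta> * \<bar>x \<beta>\<bar> powr q)" .
  qed
  also have "\<dots> = (\<Sum>\<beta>=1..N. (\<Sum>\<alpha>=1..N. P \<alpha> \<beta>) * \<bar>x \<beta>\<bar> powr q)"
    by (subst sum.swap) (simp add: sum_distrib_right)
  also have "\<dots> = vec_norm p N x powr q"
    using columns by (simp add: real vec_norm_powr[OF q])
  finally show ?thesis
    using real vec_norm_le_iff[OF q assms(2) vec_norm_nonneg[OF assms(2)]] by simp
next
  case PInf
  have x: "\<bar>x \<beta>\<bar> \<le> vec_norm p N x" if "\<beta> \<in> {1..N}" for \<beta>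
    using PInf that vec_norm_infinity_le_iff[OF assms(2), of x "vec_norm p N x"] by blast
  have "\<bar>\<Sum>\<beta>=1..N. P \<alpha> \<beta> * x \<beta>\<bar> \<le> vec_norm p N x" if \<alpha>: "\<alpha> \<in> {1..N}" for \<alpha>
  proof -
    have "\<bar>\<Sum>\<beta>=1..N. P \<alpha> \<beta> * x \<beta>\<bar> \<le> (\<Sum>\<beta>=1..N. P \<alpha> \<beta> * vec_norm p N x)"
      by (rule order_trans[OF sum_abs])
        (use nonneg \<alpha> x in \<open>auto simp: abs_mult intro!: sum_mono mult_left_mono\<close>)
    also have "\<dots> = vec_norm p N x"
      using rows[OF \<alpha>] by (simp flip: sum_distrib_right)
    finally show ?thesis .
  qed
  then show ?thesis
    using PInf vec_norm_infinity_le_iff[OF assms(2)] by blast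
qed (use assms in auto)

lemma vec_norm_average:
  assumes "1 \<le> p" "1 \<le> N"
  shows "vec_norm p N (\<lambda>_. (\<Sum>\<beta>=1..N. x \<beta>) / real N) \<le> vec_norm p N x"
proof -
  have "vec_norm p N (\<lambda>\<alpha>. \<Sum>\<beta>=1..N. 1 / real N * x \<beta>) \<le> vec_norm p N x"
    using assms by (intro vec_norm_stochastic) auto
  then show ?thesis by (simp add: sum_divide_distrib)
qed

text \<open>
  This is where the normalization of the matrix norm by the p-th root of N comes from: averaging over
  a row gains a factor 1/N in the sum of p-th powers.
\<close>

lemma vec_norm_row_average:
  assumes "1 \<le> p" "1 \<le> N"
  shows "vec_norm p N (\<lambda>\<alpha>. (\<Sum>\<beta>=1..N. \<bar>A \<alpha> \<beta>\<bar>) / real N)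
    \<le> mat_norm p N A / real N powr real_of_ereal (1 / p)"
proof (cases p)
  case (real q)
  then have q: "1 \<le> q" using assms by simp
  define S where "S = (\<Sum>\<alpha>=1..N. \<Sum>\<beta>=1..N. \<bar>A \<alpha> \<beta>\<bar> powr q)"
  have S: "0 \<le> S" unfolding S_def by (intro sum_nonneg) auto
  have "mat_norm p N A / real N powr real_of_ereal (1 / p) = (S / real N) powr (1 / q)"
    using S assms(2) q by (simp add: mat_norm_def lp_norm_def real S_def powr_divide sum.cartesian_product
        case_prod_unfold one_ereal_def)
  moreover have "(\<Sum>\<alpha>=1..N. \<bar>(\<Sum>\<beta>=1..N. \<bar>A \<alpha> \<beta>\<bar>) / real N\<bar> powr q) \<le> S / real N"
    unfolding S_def sum_divide_distrib
  proof (rule sum_mono)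
    fix \<alpha> assume \<alpha>: "\<alpha> \<in> {1..N}"
    have "\<bar>\<Sum>\<beta>=1..N. \<bar>A \<alpha> \<beta>\<bar> / real N\<bar> = (\<Sum>\<beta>=1..N. 1 / real N * \<bar>A \<alpha> \<beta>\<bar>)"
      by (simp add: sum_nonneg)
    then show "\<bar>\<Sum>\<beta>=1..N. \<bar>A \<alpha> \<beta>\<bar> / real N\<bar> powr q \<le> (\<Sum>\<beta>=1..N. \<bar>A \<alpha> \<beta>\<bar> powr q / real N)"
      using convex_on_sum[OF _ _ convex_on_powr_nonneg[OF q], of "{1..N}" "\<lambda>_. 1 / real N" "\<lambda>\<beta>. \<bar>A \<alpha> \<beta>\<bar>"]
        assms(2) by auto
  qed
  moreover have "((S / real N) powr (1 / q)) powr q = S / real N"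
    using S q by (simp add: powr_powr)
  ultimately show ?thesis
    using real vec_norm_le_iff[OF q assms(2), of "(S / real N) powr (1 / q)"] by simp
next
  case PInf
  define M where "M = mat_norm p N A"
  have A: "\<bar>A \<alpha> \<beta>\<bar> \<le> M" if "\<alpha> \<in> {1..N}" "\<beta> \<in> {1..N}" for \<alpha> \<beta>
    using that by (auto simp: M_def PInf mat_norm_def lp_norm_def intro!: Max_ge rev_image_eqI[of "(\<alpha>, \<beta>)"])
  have "\<bar>(\<Sum>\<beta>=1..N. \<bar>A \<alpha> \<beta>\<bar>) / real N\<bar> \<le> M" if "\<alpha> \<in> {1..N}" for \<alpha>
    using sum_bounded_above[of "{1..N}" "\<lambda>\<beta>. \<bar>A \<alpha> \<beta>\<bar>" M] A that assms(2)
    by (simp add: sum_nonneg divide_le_eq mult.commute)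
  then show ?thesis
    using PInf assms(2) vec_norm_infinity_le_iff[OF assms(2)] by (simp add: M_def)
qed (use assms in auto)

lemma vec_norm_const_zero:
  assumes "1 \<le> p" "1 \<le> N"
  shows "vec_norm p N (\<lambda>_. 0) = 0"
  using vec_norm_scale[OF assms, of 0 "\<lambda>_. 0"] vec_norm_nonneg[OF assms(2), of p "\<lambda>_. 0"] by simp

lemma continuous_on_vec_norm:
  fixes x :: "real \<Rightarrow> nat \<Rightarrow> real"
  assumes p: "1 \<le> p" and N: "1 \<le> N"
    and cont: "\<And>\<alpha>. \<alpha> \<in> {1..N} \<Longrightarrow> continuous_on S (\<lambda>s. x s \<alpha>)"
  shows "continuous_on S (\<lambda>s. vec_norm p N (x s))"
  unfolding continuous_on_def tendsto_iff
proof (intro ballI allI impI)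
  fix t e :: real assume t: "t \<in> S" and e: "0 < e"
  define c where "c = vec_norm p N (\<lambda>_. 1)"
  have c: "0 \<le> c" unfolding c_def by (rule vec_norm_nonneg[OF N])
  define \<epsilon> where "\<epsilon> = e / (c + 1)"
  have \<epsilon>: "0 < \<epsilon>" "\<epsilon> * c < e" using c e by (auto simp: \<epsilon>_def field_simps)
  have close: "vec_norm p N v \<le> vec_norm p N w + \<epsilon> * c"
    if "\<And>\<alpha>. \<alpha> \<in> {1..N} \<Longrightarrow> \<bar>v \<alpha> - w \<alpha>\<bar> < \<epsilon>" for v w
  proof -
    have "vec_norm p N v = vec_norm p N (\<lambda>\<alpha>. w \<alpha> + (v \<alpha> - w \<alpha>))" by simp
    also have "\<dots> \<le> vec_norm p N w + vec_norm p N (\<lambda>\<alpha>. v \<alpha> - w \<alpha>)"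
      by (rule vec_norm_triangle[OF p N])
    also have "vec_norm p N (\<lambda>\<alpha>. v \<alpha> - w \<alpha>) \<le> vec_norm p N (\<lambda>_. \<epsilon> * 1)"
      using that \<epsilon>(1) by (intro vec_norm_mono[OF p N]) (auto intro: less_imp_le)
    also have "\<dots> \<le> \<bar>\<epsilon>\<bar> * c" unfolding c_def by (rule vec_norm_scale[OF p N])
    finally show ?thesis using \<epsilon>(1) by simp
  qed
  have "\<forall>\<^sub>F s in at t within S. \<forall>\<alpha>\<in>{1..N}. dist (x s \<alpha>) (x t \<alpha>) < \<epsilon>"
    using cont t \<epsilon>(1) by (intro eventually_ball_finite) (auto simp: continuous_on_def tendsto_iff)
  then show "\<forall>\<^sub>F s in at t within S. dist (vec_norm p N (x s)) (vec_norm p N (x t)) < e"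
  proof eventually_elim
    case (elim s)
    then have "\<bar>x s \<alpha> - x t \<alpha>\<bar> < \<epsilon>" "\<bar>x t \<alpha> - x s \<alpha>\<bar> < \<epsilon>" if "\<alpha> \<in> {1..N}" for \<alpha>
      using that by (auto simp: dist_real_def abs_minus_commute)
    then show ?case
      using close[of "x s" "x t"] close[of "x t" "x s"] \<epsilon>(2) by (simp add: dist_real_def)
  qed
qed

section \<open>Differential inequalities for non-smooth functions\<close>

text \<open>
  Induction along the half line: a closed property cannot have a last time at which it holds, if it
  always persists for a short while.
\<close>

lemma real_forward_induct:
  fixes P :: "real \<Rightarrow> bool"
  assumes closed: "closed {t \<in> {0..}. P t}" and "P 0"
    and step: "\<And>t. 0 \<le> t \<Longrightarrow> P t \<Longrightarrow> \<forall>\<^sub>F s in at_right t. P s"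
    and "0 \<le> t"
  shows "P t"
proof (rule ccontr)
  assume neg: "\<not> P t"
  define S where "S = {0..t} \<inter> {t \<in> {0..}. P t}"
  have "compact S" unfolding S_def using closed by (intro compact_Int_closed) auto
  moreover have "0 \<in> S" using assms by (auto simp: S_def)
  ultimately obtain m where m: "m \<in> S" "\<And>s. s \<in> S \<Longrightarrow> s \<le> m"
    using compact_attains_sup[of S] by blast
  then have "m < t" using neg by (cases "m = t") (auto simp: S_def)
  obtain b where b: "m < b" "\<And>s. m < s \<Longrightarrow> s < b \<Longrightarrow> P s"
    using step[of m] m(1) by (auto simp: S_def eventually_at_right_field)
  define s where "s = (m + min b t) / 2"
  have s: "m < s" "s < b" "s \<le> t" using b(1) \<open>m < t\<close> by (auto simp: s_def)
  then have "s \<in> S" using b(2)[of s] m(1) by (auto simp: S_def)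
  then show False using m(2)[of s] s by simp
qed

text \<open>
  Gronwall's lemma under a bound on the upper right Dini derivative only. The product of z with the
  integrating factor exp (- a) has non-positive upper right Dini derivative at positive times, hence
  does not increase. Growth is required only for positive times; continuity takes care of the initial
  time.
\<close>

lemma dini_gronwall:
  fixes z a a' :: "real \<Rightarrow> real"
  assumes cont: "continuous_on {0..} z" "continuous_on {0..} a"
    and deriv: "\<And>t. 0 < t \<Longrightarrow> (a has_real_derivative a' t) (at t)"
    and growth: "\<And>t e. 0 < t \<Longrightarrow> 0 < e \<Longrightarrow>
      \<forall>\<^sub>F s in at_right t. z s \<le> z t + (s - t) * (a' t * z t + e)"
    and "0 \<le> t"
  shows "z t \<le> z 0 * exp (a t - a 0)"
proof -
  define h where "h s = z s * exp (- a s)" for s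
  have h: "continuous_on {0..} h"
    unfolding h_def by (intro continuous_intros cont)
  \<comment> \<open>the summand e gives a strict inequality at time 0, where no growth bound is available\<close>
  have bound: "h t \<le> h 0 + e * (1 + t)" if e: "0 < e" for e
  proof (rule real_forward_induct[where P = "\<lambda>t. h t \<le> h 0 + e * (1 + t)", OF _ _ _ \<open>0 \<le> t\<close>])
    show "closed {t \<in> {0..}. h t \<le> h 0 + e * (1 + t)}"
      by (intro continuous_on_closed_Collect_le continuous_intros h)
    show "h 0 \<le> h 0 + e * (1 + 0)" using e by simp
    fix t :: real
    assume t: "0 \<le> t" "h t \<le> h 0 + e * (1 + t)"
    show "\<forall>\<^sub>F s in at_right t. h s \<le> h 0 + e * (1 + s)"
    proof (cases "t = 0")
      case True
      have "(h \<longlongrightarrow> h 0) (at_right 0)"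
        using h by (auto simp: continuous_on_def at_within_Ici_at_right intro: tendsto_within_subset)
      then have "\<forall>\<^sub>F s in at_right 0. h s < h 0 + e"
        using e by (intro order_tendstoD) auto
      with eventually_at_right_less[of 0] show ?thesis
        unfolding True
      proof eventually_elim
        case (elim s)
        have "0 < e * s" using e elim by simp
        then show ?case using elim by (simp add: distrib_left)
      qed
    next
      case False
      then have pos: "0 < t" using t by simp
      define \<epsilon> where "\<epsilon> = e * exp (a t) / 2"
      have \<epsilon>: "0 < \<epsilon>" "\<epsilon> * exp (- a t) = e / 2"
        using e by (auto simp: \<epsilon>_def exp_minus field_simps)
      define \<phi> where "\<phi> s = (z t + (s - t) * (a' t * z t + \<epsilon>)) * exp (- a s)" for s
      have "(\<phi> has_real_derivative e / 2) (at t)"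
        unfolding \<phi>_def using \<epsilon>(2)
        by (auto intro!: derivative_eq_intros deriv[OF pos] simp: algebra_simps)
      then have "((\<lambda>s. (\<phi> s - \<phi> t) / (s - t)) \<longlongrightarrow> e / 2) (at_right t)"
        by (auto simp: has_field_derivative_iff intro: tendsto_within_subset)
      then have "\<forall>\<^sub>F s in at_right t. (\<phi> s - \<phi> t) / (s - t) < e"
        by (rule order_tendstoD) (use e in auto)
      with growth[OF pos \<epsilon>(1)] eventually_at_right_less[of t] show ?thesis
      proof eventually_elim
        case (elim s)
        have "h s \<le> \<phi> s"
          unfolding h_def \<phi>_def using elim by (intro mult_right_mono) auto
        moreover have "\<phi> s \<le> \<phi> t + e * (s - t)"
          using elim by (simp add: field_simps)
        moreover have "\<phi> t = h t" by (simp add: \<phi>_def h_def)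
        ultimately show ?case using t by (simp add: algebra_simps)
      qed
    qed
  qed
  have "h t \<le> h 0"
  proof (rule field_le_epsilon)
    fix e :: real assume "0 < e"
    then show "h t \<le> h 0 + e"
      using bound[of "e / (1 + t)"] \<open>0 \<le> t\<close> by simp
  qed
  then have "z t * exp (- a t) * exp (a t) \<le> z 0 * exp (- a 0) * exp (a t)"
    unfolding h_def by (intro mult_right_mono) auto
  then show ?thesis
    by (simp add: mult.assoc flip: exp_add)
qed

text \<open>
  A differentiable curve agrees with its Euler step up to an error of smaller order, and a norm turns
  this into a growth bound without being differentiable itself.
\<close>

lemma vec_norm_euler_step:
  fixes x :: "real \<Rightarrow> nat \<Rightarrow> real"
  assumes p: "1 \<le> p" and N: "1 \<le> N"
    and deriv: "\<And>\<alpha>. \<alpha> \<in> {1..N} \<Longrightarrow> ((\<lambda>s. x s \<alpha>) has_real_derivative d \<alpha>) (at t)"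
    and e: "0 < e"
  shows "\<forall>\<^sub>F s in at_right t.
    vec_norm p N (x s) \<le> vec_norm p N (\<lambda>\<alpha>. x t \<alpha> + (s - t) * d \<alpha>) + (s - t) * e"
proof -
  define c where "c = vec_norm p N (\<lambda>_. 1)"
  have c: "0 \<le> c" unfolding c_def by (rule vec_norm_nonneg[OF N])
  define \<epsilon> where "\<epsilon> = e / (c + 1)"
  have \<epsilon>: "0 < \<epsilon>" "\<epsilon> * c \<le> e" using c e by (auto simp: \<epsilon>_def field_simps)
  have "\<forall>\<^sub>F s in at_right t. \<forall>\<alpha>\<in>{1..N}. \<bar>(x s \<alpha> - x t \<alpha>) / (s - t) - d \<alpha>\<bar> < \<epsilon>"
  proof (intro eventually_ball_finite ballI)
    fix \<alpha> assume "\<alpha> \<in> {1..N}"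
    then have "((\<lambda>s. (x s \<alpha> - x t \<alpha>) / (s - t)) \<longlongrightarrow> d \<alpha>) (at_right t)"
      using deriv by (auto simp: has_field_derivative_iff intro: tendsto_within_subset)
    then show "\<forall>\<^sub>F s in at_right t. \<bar>(x s \<alpha> - x t \<alpha>) / (s - t) - d \<alpha>\<bar> < \<epsilon>"
      using \<epsilon>(1) by (auto simp: tendsto_iff dist_real_def)
  qed simp
  with eventually_at_right_less[of t] show ?thesis
  proof eventually_elim
    case (elim s)
    define R where "R \<alpha> = x s \<alpha> - x t \<alpha> - (s - t) * d \<alpha>" for \<alpha>
    have R: "\<bar>R \<alpha>\<bar> \<le> \<bar>(s - t) * \<epsilon> * 1\<bar>" if "\<alpha> \<in> {1..N}" for \<alpha>
    proof -
      have "R \<alpha> = (s - t) * ((x s \<alpha> - x t \<alpha>) / (s - t) - d \<alpha>)"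
        using elim(1) by (simp add: R_def field_simps)
      then show ?thesis
        using elim(1) elim(2)[rule_format, OF that] \<epsilon>(1) by (simp add: abs_mult)
    qed
    have "vec_norm p N (x s) = vec_norm p N (\<lambda>\<alpha>. (x t \<alpha> + (s - t) * d \<alpha>) + R \<alpha>)"
      by (simp add: R_def)
    also have "\<dots> \<le> vec_norm p N (\<lambda>\<alpha>. x t \<alpha> + (s - t) * d \<alpha>) + vec_norm p N R"
      by (rule vec_norm_triangle[OF p N])
    also have "vec_norm p N R \<le> vec_norm p N (\<lambda>_. (s - t) * \<epsilon> * 1)"
      by (rule vec_norm_mono[OF p N R])
    also have "\<dots> \<le> \<bar>(s - t) * \<epsilon>\<bar> * c"
      unfolding c_def by (rule vec_norm_scale[OF p N])
    also have "\<dots> \<le> (s - t) * e"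
      using elim \<epsilon> by (simp add: mult.assoc)
    finally show ?case by simp
  qed
qed

text \<open>
  After the uniform part r/N of the weights is split off, what remains of the Euler step is a
  doubly stochastic matrix Q up to the factor 1 - \<delta> r. The uniform part replaces the fraction \<delta> r
  of x by the mean of x, which produces the contraction rate r in every norm.
\<close>

lemma vec_norm_laplacian_step:
  fixes W :: "nat \<Rightarrow> nat \<Rightarrow> real"
  assumes p: "1 \<le> p" and N: "1 \<le> N"
    and sym: "\<And>\<alpha> \<beta>. \<alpha> \<in> {1..N} \<Longrightarrow> \<beta> \<in> {1..N} \<Longrightarrow> W \<alpha> \<beta> = W \<beta> \<alpha>"
    and lower: "\<And>\<alpha> \<beta>. \<alpha> \<in> {1..N} \<Longrightarrow> \<beta> \<in> {1..N} \<Longrightarrow> r / real N \<le> W \<alpha> \<beta>"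
    and upper: "\<And>\<alpha> \<beta>. \<alpha> \<in> {1..N} \<Longrightarrow> \<beta> \<in> {1..N} \<Longrightarrow> W \<alpha> \<beta> \<le> b / real N"
    and r: "0 \<le> r" and \<delta>: "0 \<le> \<delta>" "\<delta> * b < 1"
  shows "vec_norm p N (\<lambda>\<alpha>. x \<alpha> + \<delta> * (\<Sum>\<beta>=1..N. W \<alpha> \<beta> * (x \<beta> - x \<alpha>)))
    \<le> (1 - \<delta> * r) * vec_norm p N x + \<delta> * r * vec_norm p N (\<lambda>_. (\<Sum>\<beta>=1..N. x \<beta>) / real N)"
proof -
  have "r / real N \<le> b / real N" using lower[of 1 1] upper[of 1 1] N by simp
  then have "r \<le> b" using N by (simp add: divide_le_cancel)
  then have \<delta>r: "\<delta> * r < 1" using \<delta> by (meson le_less_trans mult_left_mono)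
  define Q where "Q \<alpha> \<beta> = (\<delta> * (W \<alpha> \<beta> - r / real N)
    + (if \<alpha> = \<beta> then 1 - \<delta> * (\<Sum>\<gamma>=1..N. W \<alpha> \<gamma>) else 0)) / (1 - \<delta> * r)" for \<alpha> \<beta>
  have nonneg: "0 \<le> Q \<alpha> \<beta>" if "\<alpha> \<in> {1..N}" "\<beta> \<in> {1..N}" for \<alpha> \<beta>
  proof -
    have "(\<Sum>\<gamma>=1..N. W \<alpha> \<gamma>) \<le> b"
      using sum_bounded_above[of "{1..N}" "W \<alpha>" "b / real N"] upper that N by simp
    then have "\<delta> * (\<Sum>\<gamma>=1..N. W \<alpha> \<gamma>) \<le> \<delta> * b" using \<delta> by (intro mult_left_mono)
    then show ?thesis
      unfolding Q_def using \<delta> \<delta>r lower[OF that] by (intro divide_nonneg_nonneg add_nonneg_nonneg) auto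
  qed
  have Qx: "(1 - \<delta> * r) * (\<Sum>\<beta>=1..N. Q \<alpha> \<beta> * y \<beta>) = y \<alpha> + \<delta> * (\<Sum>\<beta>=1..N. W \<alpha> \<beta> * (y \<beta> - y \<alpha>))
      - \<delta> * r * ((\<Sum>\<beta>=1..N. y \<beta>) / real N)" if "\<alpha> \<in> {1..N}" for \<alpha> y
  proof -
    have "(1 - \<delta> * r) * (\<Sum>\<beta>=1..N. Q \<alpha> \<beta> * y \<beta>) = (\<Sum>\<beta>=1..N. (\<delta> * (W \<alpha> \<beta> - r / real N)
        + (if \<alpha> = \<beta> then 1 - \<delta> * (\<Sum>\<gamma>=1..N. W \<alpha> \<gamma>) else 0)) * y \<beta>)"
      by (subst sum_distrib_left, intro sum.cong) (use \<delta>r in \<open>auto simp: Q_def\<close>)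
    also have "\<dots> = (\<Sum>\<beta>=1..N. \<delta> * (W \<alpha> \<beta> * y \<beta>) - \<delta> * r * (y \<beta> / real N)
        + (if \<alpha> = \<beta> then (1 - \<delta> * (\<Sum>\<gamma>=1..N. W \<alpha> \<gamma>)) * y \<beta> else 0))"
      by (intro sum.cong) (auto simp: algebra_simps)
    also have "\<dots> = \<delta> * (\<Sum>\<beta>=1..N. W \<alpha> \<beta> * y \<beta>) - \<delta> * r * ((\<Sum>\<beta>=1..N. y \<beta>) / real N)
        + (1 - \<delta> * (\<Sum>\<gamma>=1..N. W \<alpha> \<gamma>)) * y \<alpha>"
      unfolding sum.distrib sum_subtractf sum_distrib_left[symmetric] sum_divide_distrib[symmetric]
      using that by simp
    also have "(\<Sum>\<beta>=1..N. W \<alpha> \<beta> * y \<beta>)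
        = (\<Sum>\<beta>=1..N. W \<alpha> \<beta> * (y \<beta> - y \<alpha>)) + (\<Sum>\<beta>=1..N. W \<alpha> \<beta>) * y \<alpha>"
      by (simp add: right_diff_distrib sum_subtractf sum_distrib_right)
    finally show ?thesis
      by (simp add: algebra_simps)
  qed
  have rows: "(\<Sum>\<beta>=1..N. Q \<alpha> \<beta>) = 1" if "\<alpha> \<in> {1..N}" for \<alpha>
    using Qx[OF that, of "\<lambda>_. 1"] N \<delta>r by simp
  have Qsym: "Q \<alpha> \<beta> = Q \<beta> \<alpha>" if "\<alpha> \<in> {1..N}" "\<beta> \<in> {1..N}" for \<alpha> \<beta>
    using sym[OF that] by (auto simp: Q_def)
  have columns: "(\<Sum>\<alpha>=1..N. Q \<alpha> \<beta>) = 1" if "\<beta> \<in> {1..N}" for \<beta>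
  proof -
    have "(\<Sum>\<alpha>=1..N. Q \<alpha> \<beta>) = (\<Sum>\<alpha>=1..N. Q \<beta> \<alpha>)"
      using that Qsym by (intro sum.cong) auto
    then show ?thesis using rows[OF that] by simp
  qed
  have "vec_norm p N (\<lambda>\<alpha>. x \<alpha> + \<delta> * (\<Sum>\<beta>=1..N. W \<alpha> \<beta> * (x \<beta> - x \<alpha>)))
     = vec_norm p N (\<lambda>\<alpha>. (1 - \<delta> * r) * (\<Sum>\<beta>=1..N. Q \<alpha> \<beta> * x \<beta>)
         + \<delta> * r * ((\<Sum>\<beta>=1..N. x \<beta>) / real N))"
    using Qx by (intro vec_norm_cong_abs[OF p N]) auto
  also have "\<dots> \<le> vec_norm p N (\<lambda>\<alpha>. (1 - \<delta> * r) * (\<Sum>\<beta>=1..N. Q \<alpha> \<beta> * x \<beta>))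
      + vec_norm p N (\<lambda>\<alpha>. \<delta> * r * ((\<Sum>\<beta>=1..N. x \<beta>) / real N))"
    by (rule vec_norm_triangle[OF p N])
  also have "\<dots> \<le> \<bar>1 - \<delta> * r\<bar> * vec_norm p N (\<lambda>\<alpha>. \<Sum>\<beta>=1..N. Q \<alpha> \<beta> * x \<beta>)
      + \<bar>\<delta> * r\<bar> * vec_norm p N (\<lambda>\<alpha>. (\<Sum>\<beta>=1..N. x \<beta>) / real N)"
    by (intro add_mono vec_norm_scale[OF p N])
  also have "\<dots> \<le> (1 - \<delta> * r) * vec_norm p N x
      + \<delta> * r * vec_norm p N (\<lambda>\<alpha>. (\<Sum>\<beta>=1..N. x \<beta>) / real N)"
    using \<delta> \<delta>r r vec_norm_stochastic[OF p N nonneg rows columns, of x]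
    by (intro add_mono) (auto intro!: mult_left_mono)
  finally show ?thesis .
qed

section \<open>Linear consensus dynamics\<close>

lemma eventually_small_step:
  fixes b t :: real
  shows "\<forall>\<^sub>F s in at_right t. (s - t) * b < 1"
proof -
  have "((\<lambda>s. (s - t) * b) \<longlongrightarrow> (t - t) * b) (at_right t)"
    by (intro tendsto_intros)
  then show ?thesis by (rule order_tendstoD) simp
qed

text \<open>
  With vanishing mean the pull towards the mean in the Laplacian step is a pull towards zero.
\<close>

lemma consensus_decay:
  fixes x :: "real \<Rightarrow> nat \<Rightarrow> real" and W :: "real \<Rightarrow> nat \<Rightarrow> nat \<Rightarrow> real"
  assumes p: "1 \<le> p" and N: "1 \<le> N"
    and cont: "\<And>\<alpha>. \<alpha> \<in> {1..N} \<Longrightarrow> continuous_on {0..} (\<lambda>t. x t \<alpha>)"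
    and deriv: "\<And>t \<alpha>. 0 < t \<Longrightarrow> \<alpha> \<in> {1..N} \<Longrightarrow>
      ((\<lambda>s. x s \<alpha>) has_real_derivative (\<Sum>\<beta>=1..N. W t \<alpha> \<beta> * (x t \<beta> - x t \<alpha>))) (at t)"
    and sym: "\<And>t \<alpha> \<beta>. 0 < t \<Longrightarrow> \<alpha> \<in> {1..N} \<Longrightarrow> \<beta> \<in> {1..N} \<Longrightarrow> W t \<alpha> \<beta> = W t \<beta> \<alpha>"
    and bounds: "\<And>t \<alpha> \<beta>. 0 < t \<Longrightarrow> \<alpha> \<in> {1..N} \<Longrightarrow> \<beta> \<in> {1..N} \<Longrightarrow>
      W t \<alpha> \<beta> \<in> {r / real N..b / real N}"
    and r: "0 \<le> r"
    and mean: "\<And>t. 0 < t \<Longrightarrow> (\<Sum>\<alpha>=1..N. x t \<alpha>) = 0"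
    and t0: "0 \<le> t"
  shows "vec_norm p N (x t) \<le> vec_norm p N (x 0) * exp (- r * t)"
proof -
  have "vec_norm p N (x t) \<le> vec_norm p N (x 0) * exp (- r * t - - r * 0)"
  proof (rule dini_gronwall[where a = "\<lambda>t. - r * t" and a' = "\<lambda>_. - r" and z = "\<lambda>s. vec_norm p N (x s)", OF _ _ _ _ t0])
    show "continuous_on {0..} (\<lambda>s. vec_norm p N (x s))"
      by (rule continuous_on_vec_norm[OF p N cont])
    show "((\<lambda>t. - r * t) has_real_derivative - r) (at t)" for t
      by (auto intro!: derivative_eq_intros)
    show "continuous_on {0..} (\<lambda>t. - r * t)" by (intro continuous_intros)
    fix t e :: real assume t: "0 < t" and e: "0 < e"
    have "\<forall>\<^sub>F s in at_right t. vec_norm p N (x s) \<le> vec_norm p N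
        (\<lambda>\<alpha>. x t \<alpha> + (s - t) * (\<Sum>\<beta>=1..N. W t \<alpha> \<beta> * (x t \<beta> - x t \<alpha>))) + (s - t) * e"
      by (rule vec_norm_euler_step[OF p N deriv[OF t] e])
    then show "\<forall>\<^sub>F s in at_right t.
        vec_norm p N (x s) \<le> vec_norm p N (x t) + (s - t) * (- r * vec_norm p N (x t) + e)"
      using eventually_at_right_less[of t]
        eventually_small_step[of t b]
    proof eventually_elim
      case (elim s)
      have "vec_norm p N (\<lambda>\<alpha>. x t \<alpha> + (s - t) * (\<Sum>\<beta>=1..N. W t \<alpha> \<beta> * (x t \<beta> - x t \<alpha>)))
          \<le> (1 - (s - t) * r) * vec_norm p N (x t)
            + (s - t) * r * vec_norm p N (\<lambda>_. (\<Sum>\<beta>=1..N. x t \<beta>) / real N)"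
        using bounds[OF t] elim r
        by (intro vec_norm_laplacian_step[OF p N sym[OF t], where b = b]) auto
      also have "\<dots> = (1 - (s - t) * r) * vec_norm p N (x t)"
        using mean[OF t] vec_norm_const_zero[OF p N] by simp
      finally show ?case using elim(1) by (simp add: algebra_simps)
    qed
  qed
  then show ?thesis by simp
qed

lemma sum_antisymmetric_zero:
  fixes g :: "'a \<Rightarrow> 'a \<Rightarrow> real"
  assumes "\<And>\<alpha> \<beta>. \<alpha> \<in> I \<Longrightarrow> \<beta> \<in> I \<Longrightarrow> g \<alpha> \<beta> = - g \<beta> \<alpha>"
  shows "(\<Sum>\<alpha>\<in>I. \<Sum>\<beta>\<in>I. g \<alpha> \<beta>) = 0"
proof -
  have "(\<Sum>\<alpha>\<in>I. \<Sum>\<beta>\<in>I. g \<alpha> \<beta>) = (\<Sum>\<alpha>\<in>I. \<Sum>\<beta>\<in>I. - g \<beta> \<alpha>)"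
    by (intro sum.cong refl assms)
  also have "\<dots> = - (\<Sum>\<alpha>\<in>I. \<Sum>\<beta>\<in>I. g \<alpha> \<beta>)"
    by (subst sum.swap) (simp add: sum_negf)
  finally show ?thesis by simp
qed

lemma vec_norm_laplacian_le:
  assumes p: "1 \<le> p" and N: "1 \<le> N"
    and W: "\<And>\<alpha> \<beta>. \<alpha> \<in> {1..N} \<Longrightarrow> \<beta> \<in> {1..N} \<Longrightarrow> \<bar>W \<alpha> \<beta>\<bar> \<le> b / real N"
  shows "vec_norm p N (\<lambda>\<alpha>. \<Sum>\<beta>=1..N. W \<alpha> \<beta> * (x \<beta> - x \<alpha>)) \<le> 2 * b * vec_norm p N x"
proof -
  have b: "0 \<le> b" using order_trans[OF abs_ge_zero W[of 1 1]] N by (simp add: zero_le_divide_iff)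
  define m where "m = (\<Sum>\<beta>=1..N. \<bar>x \<beta>\<bar>) / real N"
  have m: "0 \<le> m" unfolding m_def by (intro divide_nonneg_nonneg sum_nonneg) auto
  have "vec_norm p N (\<lambda>\<alpha>. \<Sum>\<beta>=1..N. W \<alpha> \<beta> * (x \<beta> - x \<alpha>))
      \<le> vec_norm p N (\<lambda>\<alpha>. b * (m + \<bar>x \<alpha>\<bar>))"
  proof (rule vec_norm_mono[OF p N])
    fix \<alpha> assume \<alpha>: "\<alpha> \<in> {1..N}"
    have "\<bar>\<Sum>\<beta>=1..N. W \<alpha> \<beta> * (x \<beta> - x \<alpha>)\<bar> \<le> (\<Sum>\<beta>=1..N. b / real N * (\<bar>x \<beta>\<bar> + \<bar>x \<alpha>\<bar>))"
      by (rule order_trans[OF sum_abs])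
        (use W \<alpha> b in \<open>auto simp: abs_mult simp del: times_divide_eq_left intro!: sum_mono mult_mono\<close>)
    also have "\<dots> = b * (m + \<bar>x \<alpha>\<bar>)"
      unfolding m_def sum_distrib_left[symmetric] sum.distrib using N by (simp add: field_simps)
    finally show "\<bar>\<Sum>\<beta>=1..N. W \<alpha> \<beta> * (x \<beta> - x \<alpha>)\<bar> \<le> \<bar>b * (m + \<bar>x \<alpha>\<bar>)\<bar>" by linarith
  qed
  also have "\<dots> \<le> \<bar>b\<bar> * vec_norm p N (\<lambda>\<alpha>. m + \<bar>x \<alpha>\<bar>)"
    by (rule vec_norm_scale[OF p N])
  also have "\<dots> \<le> \<bar>b\<bar> * (vec_norm p N (\<lambda>_. m) + vec_norm p N (\<lambda>\<alpha>. \<bar>x \<alpha>\<bar>))"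
    by (intro mult_left_mono vec_norm_triangle[OF p N]) auto
  also have "\<dots> \<le> \<bar>b\<bar> * (vec_norm p N x + vec_norm p N x)"
    using vec_norm_average[OF p N, of "\<lambda>\<alpha>. \<bar>x \<alpha>\<bar>"]
      vec_norm_cong_abs[OF p N, of "\<lambda>\<alpha>. \<bar>x \<alpha>\<bar>" x]
    by (intro mult_left_mono add_mono) (auto simp: m_def)
  finally show ?thesis using b by (simp add: algebra_simps)
qed

text \<open>
  For constant c the quantity max (norm of x) (norm of the mean + A / r) does not grow: one Euler step
  sends the norm of x to at most a convex combination of both entries, because the pull at rate r
  absorbs the source of size A, and the mean does not move. The deviation of c from c0 makes both
  entries grow at a rate at most C exp (- l t) times the norm of the right-hand side, which is at most
  A + 2 b (norm of x). Adding A / (2 b) makes this growth proportional to the quantity itself, so that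
  Gronwall's lemma applies with an integrable rate.
\<close>

lemma perturbed_consensus_bound:
  fixes x f c :: "real \<Rightarrow> nat \<Rightarrow> real" and W :: "real \<Rightarrow> nat \<Rightarrow> nat \<Rightarrow> real"
  assumes p: "1 \<le> p" and N: "1 \<le> N"
    and cont: "\<And>\<alpha>. \<alpha> \<in> {1..N} \<Longrightarrow> continuous_on {0..} (\<lambda>t. x t \<alpha>)"
    and deriv: "\<And>t \<alpha>. 0 < t \<Longrightarrow> \<alpha> \<in> {1..N} \<Longrightarrow> ((\<lambda>s. x s \<alpha>) has_real_derivative
      c t \<alpha> * (f t \<alpha> + (\<Sum>\<beta>=1..N. W t \<alpha> \<beta> * (x t \<beta> - x t \<alpha>)))) (at t)"
    and sym: "\<And>t \<alpha> \<beta>. 0 < t \<Longrightarrow> \<alpha> \<in> {1..N} \<Longrightarrow> \<beta> \<in> {1..N} \<Longrightarrow> W t \<alpha> \<beta> = W t \<beta> \<alpha>"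
    and bounds: "\<And>t \<alpha> \<beta>. 0 < t \<Longrightarrow> \<alpha> \<in> {1..N} \<Longrightarrow> \<beta> \<in> {1..N} \<Longrightarrow>
      W t \<alpha> \<beta> \<in> {r / real N..b / real N}"
    and r: "0 < r"
    and f_sum: "\<And>t. 0 < t \<Longrightarrow> (\<Sum>\<alpha>=1..N. f t \<alpha>) = 0"
    and f_norm: "\<And>t. 0 < t \<Longrightarrow> vec_norm p N (f t) \<le> A"
    and c: "\<And>t \<alpha>. 0 < t \<Longrightarrow> \<alpha> \<in> {1..N} \<Longrightarrow> \<bar>c t \<alpha> - c0\<bar> \<le> C * exp (- l * t)"
    and c0: "0 < c0" and l: "0 < l"
    and t0: "0 \<le> t"
  shows "vec_norm p N (x t) \<le> (vec_norm p N (x 0) + A / r + A / (2 * b)) * exp (2 * b * C / l)"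
proof -
  let ?n = "vec_norm p N"
  note nonneg = vec_norm_nonneg[OF N, of p]
  have "r / real N \<le> b / real N" using bounds[of 1 1 1] N by simp
  then have rb: "r \<le> b" using N by (simp add: divide_le_cancel)
  then have b: "0 < b" using r by simp
  have A: "0 \<le> A" using order_trans[OF nonneg f_norm[of 1]] by simp
  have "0 \<le> C * exp (- l * 1)" using order_trans[OF abs_ge_zero c[of 1 1]] N by simp
  then have C: "0 \<le> C" by (simp add: zero_le_mult_iff)
  define v where "v s = ?n (\<lambda>_. (\<Sum>\<beta>=1..N. x s \<beta>) / real N)" for s
  define z where "z s = max (?n (x s)) (v s + A / r) + A / (2 * b)" for s
  have z: "?n (x s) + A / (2 * b) \<le> z s" "v s + A / r + A / (2 * b) \<le> z s" for s
    by (auto simp: z_def)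
  define a where "a s = - (2 * b * C / l) * exp (- l * s)" for s
  have "z t \<le> z 0 * exp (a t - a 0)"
  proof (rule dini_gronwall[where a' = "\<lambda>t. 2 * b * (C * exp (- l * t))", OF _ _ _ _ t0])
    show "continuous_on {0..} z"
      unfolding z_def v_def using N
      by (intro continuous_intros continuous_on_vec_norm[OF p N] cont) auto
    show "continuous_on {0..} a" unfolding a_def by (intro continuous_intros)
    show "(a has_real_derivative 2 * b * (C * exp (- l * t))) (at t)" for t
      unfolding a_def using l by (auto intro!: derivative_eq_intros)
    fix t e :: real assume t: "0 < t" and e: "0 < e"
    define E where "E = C * exp (- l * t)"
    have E: "0 \<le> E" using C by (simp add: E_def)
    define Lx where "Lx \<alpha> = (\<Sum>\<beta>=1..N. W t \<alpha> \<beta> * (x t \<beta> - x t \<alpha>))" for \<alpha>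
    define R where "R \<alpha> = f t \<alpha> + Lx \<alpha>" for \<alpha>
    define P where "P \<alpha> = (c t \<alpha> - c0) * R \<alpha>" for \<alpha>
    have W0: "0 \<le> W t \<alpha> \<beta>" if "\<alpha> \<in> {1..N}" "\<beta> \<in> {1..N}" for \<alpha> \<beta>
    proof -
      have "0 \<le> r / real N" using r by simp
      then show ?thesis using bounds[OF t that] unfolding atLeastAtMost_iff by linarith
    qed
    have "?n R \<le> ?n (f t) + ?n Lx"
      unfolding R_def by (rule vec_norm_triangle[OF p N])
    also have "?n Lx \<le> 2 * b * ?n (x t)"
      unfolding Lx_def by (rule vec_norm_laplacian_le[OF p N]) (use W0 bounds[OF t] in simp)
    also have "?n (f t) + 2 * b * ?n (x t) \<le> 2 * b * (?n (x t) + A / (2 * b))"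
      using f_norm[OF t] b by (simp add: field_simps)
    finally have nR: "?n R \<le> 2 * b * z t"
      using z(1)[of t] b by (smt (verit) mult_left_mono)
    have "?n P \<le> ?n (\<lambda>\<alpha>. E * R \<alpha>)"
      using c[OF t] E by (intro vec_norm_mono[OF p N])
        (auto simp: P_def abs_mult E_def C intro!: mult_right_mono)
    also have "\<dots> \<le> \<bar>E\<bar> * ?n R" by (rule vec_norm_scale[OF p N])
    also have "\<dots> \<le> E * (2 * b * z t)" using E nR by (simp add: mult_left_mono)
    finally have nP: "?n P \<le> 2 * b * E * z t" by (simp add: algebra_simps)
    have sumL: "(\<Sum>\<alpha>=1..N. Lx \<alpha>) = 0"
      unfolding Lx_def by (rule sum_antisymmetric_zero) (use sym[OF t] in \<open>auto simp: algebra_simps\<close>)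
    have d: "c t \<alpha> * (f t \<alpha> + Lx \<alpha>) = c0 * Lx \<alpha> + (c0 * f t \<alpha> + P \<alpha>)" for \<alpha>
      by (simp add: P_def R_def algebra_simps)
    have "((\<lambda>s. (\<Sum>\<beta>=1..N. x s \<beta>) / real N) has_real_derivative
        (\<Sum>\<beta>=1..N. c t \<beta> * (f t \<beta> + Lx \<beta>)) / real N) (at t)"
      unfolding Lx_def by (intro DERIV_cdivide DERIV_sum deriv[OF t])
    moreover have "(\<Sum>\<beta>=1..N. c t \<beta> * (f t \<beta> + Lx \<beta>)) = (\<Sum>\<beta>=1..N. P \<beta>)"
      using sumL f_sum[OF t] by (simp add: d sum.distrib flip: sum_distrib_left)
    ultimately have mean_deriv: "((\<lambda>s. (\<Sum>\<beta>=1..N. x s \<beta>) / real N) has_real_derivative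
        (\<Sum>\<beta>=1..N. P \<beta>) / real N) (at t)" by simp
    have "\<forall>\<^sub>F s in at_right t. ?n (x s) \<le>
        ?n (\<lambda>\<alpha>. x t \<alpha> + (s - t) * (c t \<alpha> * (f t \<alpha> + Lx \<alpha>))) + (s - t) * e"
      unfolding Lx_def by (rule vec_norm_euler_step[OF p N deriv[OF t] e])
    moreover have "\<forall>\<^sub>F s in at_right t. v s \<le>
        ?n (\<lambda>_. (\<Sum>\<beta>=1..N. x t \<beta>) / real N + (s - t) * ((\<Sum>\<beta>=1..N. P \<beta>) / real N)) + (s - t) * e"
      unfolding v_def by (rule vec_norm_euler_step[OF p N mean_deriv e])
    ultimately show "\<forall>\<^sub>F s in at_right t. z s \<le> z t + (s - t) * (2 * b * (C * exp (- l * t)) * z t + e)"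
      using eventually_at_right_less[of t] eventually_small_step[of t "c0 * b"]
    proof eventually_elim
      case (elim s)
      define \<delta> where "\<delta> = s - t"
      have \<delta>: "0 < \<delta>" "\<delta> * c0 * b < 1" using elim by (auto simp: \<delta>_def mult.assoc)
      \<comment> \<open>\<rho> is the weight of the mean in the Euler step of length \<delta>\<close>
      define \<rho> where "\<rho> = \<delta> * c0 * r"
      have "\<rho> \<le> \<delta> * c0 * b" using \<delta> c0 rb by (simp add: \<rho>_def)
      then have \<rho>: "0 < \<rho>" "\<rho> < 1" using \<delta> c0 r by (simp add: \<rho>_def, linarith)
      have "?n (\<lambda>\<alpha>. x t \<alpha> + \<delta> * (c t \<alpha> * (f t \<alpha> + Lx \<alpha>)))
          = ?n (\<lambda>\<alpha>. (x t \<alpha> + \<delta> * c0 * Lx \<alpha>) + \<delta> * (c0 * f t \<alpha> + P \<alpha>))"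
        unfolding d by (simp add: algebra_simps)
      also have "\<dots> \<le> ?n (\<lambda>\<alpha>. x t \<alpha> + \<delta> * c0 * Lx \<alpha>) + ?n (\<lambda>\<alpha>. \<delta> * (c0 * f t \<alpha> + P \<alpha>))"
        by (rule vec_norm_triangle[OF p N])
      also have "?n (\<lambda>\<alpha>. x t \<alpha> + \<delta> * c0 * Lx \<alpha>) \<le> (1 - \<rho>) * ?n (x t) + \<rho> * v t"
        unfolding Lx_def v_def \<rho>_def using bounds[OF t] r c0 \<delta>
        by (intro vec_norm_laplacian_step[OF p N sym[OF t], where b = b]) auto
      also have "?n (\<lambda>\<alpha>. \<delta> * (c0 * f t \<alpha> + P \<alpha>)) \<le> \<bar>\<delta>\<bar> * ?n (\<lambda>\<alpha>. c0 * f t \<alpha> + P \<alpha>)"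
        by (rule vec_norm_scale[OF p N])
      also have "?n (\<lambda>\<alpha>. c0 * f t \<alpha> + P \<alpha>) \<le> ?n (\<lambda>\<alpha>. c0 * f t \<alpha>) + ?n P"
        by (rule vec_norm_triangle[OF p N])
      also have "?n (\<lambda>\<alpha>. c0 * f t \<alpha>) \<le> \<bar>c0\<bar> * ?n (f t)" by (rule vec_norm_scale[OF p N])
      also have "?n (f t) \<le> A" by (rule f_norm[OF t])
      finally have "?n (\<lambda>\<alpha>. x t \<alpha> + \<delta> * (c t \<alpha> * (f t \<alpha> + Lx \<alpha>)))
          \<le> (1 - \<rho>) * ?n (x t) + \<rho> * v t + \<delta> * (c0 * A + ?n P)"
        using \<delta> c0 by (simp add: mult_left_mono)
      also have "\<dots> = (1 - \<rho>) * ?n (x t) + \<rho> * (v t + A / r) + \<delta> * ?n P"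
        using r by (simp add: \<rho>_def algebra_simps)
      also have "(1 - \<rho>) * ?n (x t) + \<rho> * (v t + A / r) \<le> z t - A / (2 * b)"
        using \<rho> z[of t] by (intro convex_bound_le) auto
      also have "\<delta> * ?n P \<le> \<delta> * (2 * b * E * z t)" using \<delta> nP by (intro mult_left_mono) auto
      finally have u: "?n (\<lambda>\<alpha>. x t \<alpha> + \<delta> * (c t \<alpha> * (f t \<alpha> + Lx \<alpha>)))
          \<le> z t - A / (2 * b) + \<delta> * (2 * b * E * z t)"
        by simp
      have "?n (\<lambda>_. (\<Sum>\<beta>=1..N. x t \<beta>) / real N + \<delta> * ((\<Sum>\<beta>=1..N. P \<beta>) / real N))
          \<le> v t + ?n (\<lambda>_. \<delta> * ((\<Sum>\<beta>=1..N. P \<beta>) / real N))"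
        unfolding v_def by (rule vec_norm_triangle[OF p N])
      also have "?n (\<lambda>_. \<delta> * ((\<Sum>\<beta>=1..N. P \<beta>) / real N)) \<le> \<bar>\<delta>\<bar> * ?n (\<lambda>_. (\<Sum>\<beta>=1..N. P \<beta>) / real N)"
        by (rule vec_norm_scale[OF p N])
      also have "?n (\<lambda>_. (\<Sum>\<beta>=1..N. P \<beta>) / real N) \<le> ?n P" by (rule vec_norm_average[OF p N])
      also note nP
      finally have w: "?n (\<lambda>_. (\<Sum>\<beta>=1..N. x t \<beta>) / real N + \<delta> * ((\<Sum>\<beta>=1..N. P \<beta>) / real N))
          \<le> v t + \<delta> * (2 * b * E * z t)"
        using \<delta> by (simp add: mult_left_mono)
      have "?n (x s) \<le> z t - A / (2 * b) + \<delta> * (2 * b * E * z t) + \<delta> * e"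
        using u elim(1) by (simp add: \<delta>_def)
      moreover have "v s \<le> v t + \<delta> * (2 * b * E * z t) + \<delta> * e"
        using w elim(2) by (simp add: \<delta>_def)
      ultimately have "max (?n (x s)) (v s + A / r)
          \<le> z t - A / (2 * b) + \<delta> * (2 * b * E * z t) + \<delta> * e"
        using z(2)[of t] by (intro max.boundedI) linarith+
      then have "z s \<le> z t + \<delta> * (2 * b * E * z t) + \<delta> * e"
        unfolding z_def[of s] by linarith
      then show ?case by (simp add: \<delta>_def E_def algebra_simps)
    qed
  qed
  also have "\<dots> \<le> (?n (x 0) + A / r + A / (2 * b)) * exp (2 * b * C / l)"
  proof (rule mult_mono)
    show "z 0 \<le> ?n (x 0) + A / r + A / (2 * b)"
      unfolding z_def v_def using vec_norm_average[OF p N, of "x 0"] A r by simp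
    have "a t - a 0 \<le> 2 * b * C / l" unfolding a_def using b C l by simp
    then show "exp (a t - a 0) \<le> exp (2 * b * C / l)" by simp
    show "0 \<le> ?n (x 0) + A / r + A / (2 * b)" using nonneg A r b by simp
  qed simp
  finally show ?thesis using z(1)[of t] A b by (smt (verit) divide_nonneg_pos)
qed

section \<open>Difference quotients as symmetric weights\<close>

lemma Qinv_commute: "Qinv F x y = Qinv F y x"
  unfolding Qinv_def by (metis minus_diff_eq minus_divide_divide)

text \<open>
  The difference quotient plays two roles: for the response function F it converts forces into
  velocities, and for the sine, where its reciprocal is a slope of the sine, it converts phase
  differences into coupling forces. Being symmetric, it yields symmetric weights in both cases.
\<close>

lemma Qinv_mean_value:
  assumes xy: "x \<in> {l..u}" "y \<in> {l..u}"
    and deriv: "\<And>\<xi>. \<xi> \<in> {l..u} \<Longrightarrow> (F has_real_derivative deriv F \<xi>) (at \<xi>)"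
    and pos: "\<And>\<xi>. \<xi> \<in> {l..u} \<Longrightarrow> 0 < deriv F \<xi>"
  obtains \<xi> where "\<xi> \<in> {l..u}" "min x y \<le> \<xi>" "\<xi> \<le> max x y" "Qinv F x y = 1 / deriv F \<xi>"
    "x - y = Qinv F x y * (F x - F y)"
proof -
  have *: "\<exists>\<xi>. \<xi> \<in> {l..u} \<and> a \<le> \<xi> \<and> \<xi> \<le> b \<and> Qinv F a b = 1 / deriv F \<xi>
      \<and> a - b = Qinv F a b * (F a - F b)" if ab: "a < b" "a \<in> {l..u}" "b \<in> {l..u}" for a b
  proof -
    obtain \<xi> where \<xi>: "a < \<xi>" "\<xi> < b" "F b - F a = (b - a) * deriv F \<xi>"
      using MVT2[OF ab(1), of F "deriv F"] deriv ab by auto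
    then have "0 < deriv F \<xi>" using pos ab by auto
    moreover have "F a - F b = (a - b) * deriv F \<xi>" using \<xi>(3) by (simp add: algebra_simps)
    ultimately show ?thesis using \<xi> ab by (intro exI[of _ \<xi>]) (simp add: Qinv_def)
  qed
  consider "x = y" | "x < y" | "y < x" by linarith
  then show thesis
  proof cases
    case 1
    then show thesis using xy by (intro that[of x]) (auto simp: Qinv_def)
  next
    case 2
    then show thesis using *[OF 2 xy] that by auto
  next
    case 3
    obtain \<xi> where \<xi>: "\<xi> \<in> {l..u}" "y \<le> \<xi>" "\<xi> \<le> x" "Qinv F y x = 1 / deriv F \<xi>"
        "y - x = Qinv F y x * (F y - F x)"
      using *[OF 3 xy(2,1)] by blast
    have "x - y = Qinv F y x * (F x - F y)"
      using \<xi>(5) by (simp add: algebra_simps)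
    then show thesis using \<xi> 3 Qinv_commute[of F x y] by (intro that[of \<xi>]) auto
  qed
qed

lemma Qinv_sin:
  assumes "\<bar>a\<bar> \<le> \<theta>" "\<bar>b\<bar> \<le> \<theta>" "\<theta> < pi / 2"
  shows "1 / Qinv sin a b \<in> {cos \<theta>..1}" "sin a - sin b = 1 / Qinv sin a b * (a - b)"
proof -
  have d: "deriv sin \<xi> = cos \<xi>" for \<xi> :: real by (rule DERIV_imp_deriv[OF DERIV_sin])
  have cos: "cos \<theta> \<le> cos \<xi>" "0 < cos \<xi>" if "\<xi> \<in> {-\<theta>..\<theta>}" for \<xi>
    using cos_monotone_0_pi_le[of "\<bar>\<xi>\<bar>" \<theta>] cos_gt_zero_pi[of \<xi>] that assms by auto
  obtain \<xi> where \<xi>: "\<xi> \<in> {-\<theta>..\<theta>}" "Qinv sin a b = 1 / deriv sin \<xi>"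
      "a - b = Qinv sin a b * (sin a - sin b)"
    by (rule Qinv_mean_value[of a "-\<theta>" \<theta> b sin]) (use assms cos in \<open>auto simp: d\<close>)
  then show "1 / Qinv sin a b \<in> {cos \<theta>..1}" using cos by (simp add: d)
  show "sin a - sin b = 1 / Qinv sin a b * (a - b)" using \<xi> cos[of \<xi>] by (simp add: d)
qed

lemma Qinv_sin_minus: "Qinv sin (- a) (- b) = Qinv sin a b"
proof -
  have "(b - a) / (sin b - sin a) = (a - b) / (sin a - sin b)"
    by (metis minus_diff_eq minus_divide_divide)
  then show ?thesis by (simp add: Qinv_def DERIV_imp_deriv[OF DERIV_sin])
qed

section \<open>The coupling force and the phase diameter\<close>

definition coupling :: "real \<Rightarrow> nat \<Rightarrow> (nat \<Rightarrow> nat \<Rightarrow> real) \<Rightarrow> (nat \<Rightarrow> real) \<Rightarrow> nat \<Rightarrow> real" where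
  "coupling \<kappa> N \<phi> \<theta> \<alpha> = \<kappa> / real N * (\<Sum>\<beta>=1..N. \<phi> \<alpha> \<beta> * sin (\<theta> \<beta> - \<theta> \<alpha>))"

lemma coupling_bound:
  assumes "1 \<le> N" "0 \<le> \<kappa>" "\<And>\<beta>. \<beta> \<in> {1..N} \<Longrightarrow> \<bar>\<phi> \<alpha> \<beta>\<bar> \<le> b"
  shows "\<bar>coupling \<kappa> N \<phi> \<theta> \<alpha>\<bar> \<le> \<kappa> * b"
proof -
  have "\<bar>\<Sum>\<beta>=1..N. \<phi> \<alpha> \<beta> * sin (\<theta> \<beta> - \<theta> \<alpha>)\<bar> \<le> (\<Sum>\<beta>=1..N. b * 1)"
  proof (rule order_trans[OF sum_abs], rule sum_mono)
    fix \<beta> assume \<beta>: "\<beta> \<in> {1..N}"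
    show "\<bar>\<phi> \<alpha> \<beta> * sin (\<theta> \<beta> - \<theta> \<alpha>)\<bar> \<le> b * 1"
      unfolding abs_mult
      by (rule mult_mono) (use assms(3)[OF \<beta>] order_trans[OF abs_ge_zero assms(3)[OF \<beta>]] in simp_all)
  qed
  then have "\<kappa> / real N * \<bar>\<Sum>\<beta>=1..N. \<phi> \<alpha> \<beta> * sin (\<theta> \<beta> - \<theta> \<alpha>)\<bar> \<le> \<kappa> / real N * (real N * b)"
    using assms by (intro mult_left_mono) auto
  then show ?thesis using assms by (simp add: coupling_def abs_mult)
qed

lemma sum_coupling_eq_0:
  assumes "\<And>\<alpha> \<beta>. \<alpha> \<in> {1..N} \<Longrightarrow> \<beta> \<in> {1..N} \<Longrightarrow> \<phi> \<alpha> \<beta> = \<phi> \<beta> \<alpha>"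
  shows "(\<Sum>\<alpha>=1..N. coupling \<kappa> N \<phi> \<theta> \<alpha>) = 0"
proof -
  have "(\<Sum>\<alpha>=1..N. \<Sum>\<beta>=1..N. \<phi> \<alpha> \<beta> * sin (\<theta> \<beta> - \<theta> \<alpha>)) = 0"
  proof (rule sum_antisymmetric_zero)
    fix \<alpha> \<beta> assume "\<alpha> \<in> {1..N}" "\<beta> \<in> {1..N}"
    then have "\<phi> \<alpha> \<beta> = \<phi> \<beta> \<alpha>" by (rule assms)
    moreover have "sin (\<theta> \<beta> - \<theta> \<alpha>) = - sin (\<theta> \<alpha> - \<theta> \<beta>)" by (simp flip: sin_minus)
    ultimately show "\<phi> \<alpha> \<beta> * sin (\<theta> \<beta> - \<theta> \<alpha>) = - (\<phi> \<beta> \<alpha> * sin (\<theta> \<alpha> - \<theta> \<beta>))" by simp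
  qed
  then show ?thesis unfolding coupling_def sum_distrib_left[symmetric] by simp
qed

lemma continuous_on_coupling:
  fixes \<Theta> :: "real \<Rightarrow> nat \<Rightarrow> real"
  assumes "\<And>\<alpha>. \<alpha> \<in> {1..N} \<Longrightarrow> continuous_on S (\<lambda>t. \<Theta> t \<alpha>)" "\<alpha> \<in> {1..N}"
  shows "continuous_on S (\<lambda>t. coupling \<kappa> N \<phi> (\<Theta> t) \<alpha>)"
  unfolding coupling_def by (intro continuous_intros assms)

lemma coupling_has_derivative:
  assumes "\<And>\<alpha>. \<alpha> \<in> {1..N} \<Longrightarrow> ((\<lambda>s. \<Theta> s \<alpha>) has_real_derivative \<omega> \<alpha>) (at t)" "\<alpha> \<in> {1..N}"
  shows "((\<lambda>s. coupling \<kappa> N \<phi> (\<Theta> s) \<alpha>) has_real_derivative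
    (\<Sum>\<beta>=1..N. \<kappa> / real N * \<phi> \<alpha> \<beta> * cos (\<Theta> t \<beta> - \<Theta> t \<alpha>) * (\<omega> \<beta> - \<omega> \<alpha>))) (at t)"
proof -
  have "((\<lambda>s. \<Sum>\<beta>=1..N. \<kappa> / real N * (\<phi> \<alpha> \<beta> * sin (\<Theta> s \<beta> - \<Theta> s \<alpha>))) has_real_derivative
    (\<Sum>\<beta>=1..N. \<kappa> / real N * \<phi> \<alpha> \<beta> * cos (\<Theta> t \<beta> - \<Theta> t \<alpha>) * (\<omega> \<beta> - \<omega> \<alpha>))) (at t)"
    by (intro DERIV_sum) (use assms in \<open>auto intro!: derivative_eq_intros\<close>)
  then show ?thesis by (simp only: coupling_def sum_distrib_left)
qed

text \<open>
  If the pair \<alpha>, \<beta> realizes the diameter, every oscillator lies between the two, so all terms of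
  the coupling push them together; subadditivity of the sine, sin (a + b) \<le> sin a + sin b, bounds the push
  of each oscillator from below by the sine of the full gap.
\<close>

lemma coupling_contracts_extremal_pair:
  assumes N: "1 \<le> N" and "0 \<le> \<kappa>" "0 \<le> m" and \<phi>: "\<And>\<beta> \<gamma>. \<beta> \<in> {1..N} \<Longrightarrow> \<gamma> \<in> {1..N} \<Longrightarrow> m \<le> \<phi> \<beta> \<gamma>"
    and \<alpha>\<beta>: "\<alpha> \<in> {1..N}" "\<beta> \<in> {1..N}" and ext: "\<theta> \<alpha> - \<theta> \<beta> = \<theta>s" and "\<theta>s < pi / 2"
    and phases: "\<And>\<gamma> \<gamma>'. \<gamma> \<in> {1..N} \<Longrightarrow> \<gamma>' \<in> {1..N} \<Longrightarrow> \<theta> \<gamma> - \<theta> \<gamma>' \<le> \<theta>s"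
  shows "coupling \<kappa> N \<phi> \<theta> \<alpha> - coupling \<kappa> N \<phi> \<theta> \<beta> \<le> - (\<kappa> * m * sin \<theta>s)"
proof -
  have "(\<Sum>\<gamma>=1..N. \<phi> \<alpha> \<gamma> * sin (\<theta> \<gamma> - \<theta> \<alpha>)) - (\<Sum>\<gamma>=1..N. \<phi> \<beta> \<gamma> * sin (\<theta> \<gamma> - \<theta> \<beta>))
      = (\<Sum>\<gamma>=1..N. - (\<phi> \<alpha> \<gamma> * sin (\<theta> \<alpha> - \<theta> \<gamma>) + \<phi> \<beta> \<gamma> * sin (\<theta> \<gamma> - \<theta> \<beta>)))"
  proof -
    have "sin (\<theta> \<gamma> - \<theta> \<alpha>) = - sin (\<theta> \<alpha> - \<theta> \<gamma>)" for \<gamma> by (simp flip: sin_minus)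
    then show ?thesis by (simp add: sum_subtractf[symmetric] sum_negf[symmetric])
  qed
  also have "\<dots> \<le> (\<Sum>\<gamma>=1..N. - (m * sin \<theta>s))"
  proof (rule sum_mono)
    fix \<gamma> assume \<gamma>: "\<gamma> \<in> {1..N}"
    define a b where "a = \<theta> \<alpha> - \<theta> \<gamma>" and "b = \<theta> \<gamma> - \<theta> \<beta>"
    have ab: "0 \<le> a" "0 \<le> b" "a + b = \<theta>s"
      using phases[OF \<gamma> \<alpha>\<beta>(2)] phases[OF \<alpha>\<beta>(1) \<gamma>] ext by (auto simp: a_def b_def)
    have pos: "0 \<le> sin a" "0 \<le> sin b"
      using ab \<open>\<theta>s < pi / 2\<close> by (auto intro!: sin_ge_zero)
    have "sin \<theta>s = sin a * cos b + cos a * sin b" using ab by (simp flip: sin_add)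
    also have "\<dots> \<le> sin a * 1 + 1 * sin b"
      using pos by (intro add_mono mult_left_mono mult_right_mono) auto
    finally have "m * sin \<theta>s \<le> m * (sin a * 1 + 1 * sin b)"
      using \<open>0 \<le> m\<close> by (rule mult_left_mono)
    then have "m * sin \<theta>s \<le> m * sin a + m * sin b" by (simp add: distrib_left)
    also have "m * sin a + m * sin b \<le> \<phi> \<alpha> \<gamma> * sin a + \<phi> \<beta> \<gamma> * sin b"
      using pos \<phi>[OF \<alpha>\<beta>(1) \<gamma>] \<phi>[OF \<alpha>\<beta>(2) \<gamma>] by (intro add_mono mult_right_mono) auto
    finally show "- (\<phi> \<alpha> \<gamma> * sin (\<theta> \<alpha> - \<theta> \<gamma>) + \<phi> \<beta> \<gamma> * sin (\<theta> \<gamma> - \<theta> \<beta>)) \<le> - (m * sin \<theta>s)"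
      by (simp add: a_def b_def)
  qed
  finally have "\<kappa> / real N * ((\<Sum>\<gamma>=1..N. \<phi> \<alpha> \<gamma> * sin (\<theta> \<gamma> - \<theta> \<alpha>)) - (\<Sum>\<gamma>=1..N. \<phi> \<beta> \<gamma> * sin (\<theta> \<gamma> - \<theta> \<beta>)))
      \<le> \<kappa> / real N * (\<Sum>\<gamma>=1..N. - (m * sin \<theta>s))"
    using \<open>0 \<le> \<kappa>\<close> by (intro mult_left_mono) auto
  then show ?thesis using N by (simp add: coupling_def right_diff_distrib)
qed

text \<open>
  At a time at which some pair is exactly \<theta>s apart, the forces on the pair are strictly ordered, and
  remain so for a short time by continuity, so the gap of the pair shrinks. The other pairs need time
  to reach \<theta>s. Strictness of the ordering makes this work at time 0 as well, where the phases need
  not be differentiable.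
\<close>

lemma phase_diameter_invariant:
  fixes \<Theta> \<omega> :: "real \<Rightarrow> nat \<Rightarrow> real"
  assumes N: "1 \<le> N" and "0 \<le> \<kappa>" and m: "0 \<le> m"
    and \<phi>: "\<And>\<beta> \<gamma>. \<beta> \<in> {1..N} \<Longrightarrow> \<gamma> \<in> {1..N} \<Longrightarrow> m \<le> \<phi> \<beta> \<gamma>"
    and cont: "\<And>\<alpha>. \<alpha> \<in> {1..N} \<Longrightarrow> continuous_on {0..} (\<lambda>t. \<Theta> t \<alpha>)"
    and deriv: "\<And>t \<alpha>. 0 < t \<Longrightarrow> \<alpha> \<in> {1..N} \<Longrightarrow> ((\<lambda>s. \<Theta> s \<alpha>) has_real_derivative \<omega> t \<alpha>) (at t)"
    and mono: "\<And>t \<alpha> \<beta>. 0 < t \<Longrightarrow> \<alpha> \<in> {1..N} \<Longrightarrow> \<beta> \<in> {1..N} \<Longrightarrow>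
      \<nu> \<alpha> + coupling \<kappa> N \<phi> (\<Theta> t) \<alpha> < \<nu> \<beta> + coupling \<kappa> N \<phi> (\<Theta> t) \<beta> \<Longrightarrow> \<omega> t \<alpha> < \<omega> t \<beta>"
    and \<theta>s: "\<theta>s < pi / 2"
    and \<nu>: "\<And>\<alpha> \<beta>. \<alpha> \<in> {1..N} \<Longrightarrow> \<beta> \<in> {1..N} \<Longrightarrow> \<nu> \<alpha> - \<nu> \<beta> < \<kappa> * m * sin \<theta>s"
    and init: "\<And>\<alpha> \<beta>. \<alpha> \<in> {1..N} \<Longrightarrow> \<beta> \<in> {1..N} \<Longrightarrow> \<Theta> 0 \<alpha> - \<Theta> 0 \<beta> \<le> \<theta>s"
    and "0 \<le> t" "\<alpha> \<in> {1..N}" "\<beta> \<in> {1..N}"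
  shows "\<Theta> t \<alpha> - \<Theta> t \<beta> \<le> \<theta>s"
proof -
  have "\<forall>\<alpha>\<in>{1..N}. \<forall>\<beta>\<in>{1..N}. \<Theta> t \<alpha> - \<Theta> t \<beta> \<le> \<theta>s"
  proof (rule real_forward_induct[OF _ _ _ \<open>0 \<le> t\<close>])
    have "closed (\<Inter>\<alpha>\<in>{1..N}. \<Inter>\<beta>\<in>{1..N}. {t \<in> {0..}. \<Theta> t \<alpha> - \<Theta> t \<beta> \<le> \<theta>s})"
      by (intro closed_INT ballI continuous_on_closed_Collect_le continuous_intros cont) auto
    moreover have "{t \<in> {0..}. \<forall>\<alpha>\<in>{1..N}. \<forall>\<beta>\<in>{1..N}. \<Theta> t \<alpha> - \<Theta> t \<beta> \<le> \<theta>s}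
        = (\<Inter>\<alpha>\<in>{1..N}. \<Inter>\<beta>\<in>{1..N}. {t \<in> {0..}. \<Theta> t \<alpha> - \<Theta> t \<beta> \<le> \<theta>s})"
      using N by fastforce
    ultimately show "closed {t \<in> {0..}. \<forall>\<alpha>\<in>{1..N}. \<forall>\<beta>\<in>{1..N}. \<Theta> t \<alpha> - \<Theta> t \<beta> \<le> \<theta>s}"
      by simp
    fix t :: real assume t: "0 \<le> t" and P: "\<forall>\<alpha>\<in>{1..N}. \<forall>\<beta>\<in>{1..N}. \<Theta> t \<alpha> - \<Theta> t \<beta> \<le> \<theta>s"
    have right: "(g \<longlongrightarrow> g t) (at_right t)" if "continuous_on {0..} g" for g :: "real \<Rightarrow> real"
      using that t unfolding continuous_on_def by (auto intro: tendsto_within_subset)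
    have "\<forall>\<^sub>F s in at_right t. \<Theta> s \<alpha> - \<Theta> s \<beta> \<le> \<theta>s" if \<alpha>\<beta>: "\<alpha> \<in> {1..N}" "\<beta> \<in> {1..N}" for \<alpha> \<beta>
    proof (cases "\<Theta> t \<alpha> - \<Theta> t \<beta> < \<theta>s")
      case True
      have "((\<lambda>s. \<Theta> s \<alpha> - \<Theta> s \<beta>) \<longlongrightarrow> \<Theta> t \<alpha> - \<Theta> t \<beta>) (at_right t)"
        using \<alpha>\<beta> by (intro tendsto_diff right cont)
      then have "\<forall>\<^sub>F s in at_right t. \<Theta> s \<alpha> - \<Theta> s \<beta> < \<theta>s" by (rule order_tendstoD) (rule True)
      then show ?thesis by eventually_elim simp
    next
      case False
      then have ext: "\<Theta> t \<alpha> - \<Theta> t \<beta> = \<theta>s" using P \<alpha>\<beta> by force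
      define g where "g s = \<nu> \<alpha> + coupling \<kappa> N \<phi> (\<Theta> s) \<alpha> - (\<nu> \<beta> + coupling \<kappa> N \<phi> (\<Theta> s) \<beta>)" for s
      have "continuous_on {0..} g"
        unfolding g_def using \<alpha>\<beta> by (intro continuous_intros continuous_on_coupling cont)
      moreover have "coupling \<kappa> N \<phi> (\<Theta> t) \<alpha> - coupling \<kappa> N \<phi> (\<Theta> t) \<beta> \<le> - (\<kappa> * m * sin \<theta>s)"
        using P by (intro coupling_contracts_extremal_pair[OF N \<open>0 \<le> \<kappa>\<close> m \<phi> \<alpha>\<beta> ext \<theta>s]) auto
      then have "g t < 0" using \<nu>[OF \<alpha>\<beta>] by (simp add: g_def)
      ultimately have "\<forall>\<^sub>F s in at_right t. g s < 0" by (intro order_tendstoD(2)[OF right])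
      then obtain b where b: "t < b" "\<And>s. t < s \<Longrightarrow> s < b \<Longrightarrow> g s < 0"
        by (auto simp: eventually_at_right_field)
      have "\<Theta> s \<alpha> - \<Theta> s \<beta> \<le> \<theta>s" if s: "t < s" "s < b" for s
      proof -
        have "\<Theta> s \<alpha> - \<Theta> s \<beta> < \<Theta> t \<alpha> - \<Theta> t \<beta>"
        proof (rule DERIV_neg_imp_decreasing_open[where f = "\<lambda>s. \<Theta> s \<alpha> - \<Theta> s \<beta>", OF s(1)])
          fix \<tau> assume \<tau>: "t < \<tau>" "\<tau> < s"
          then have "\<omega> \<tau> \<alpha> < \<omega> \<tau> \<beta>"
            using b(2)[of \<tau>] s t \<alpha>\<beta> by (intro mono) (auto simp: g_def)
          moreover have "((\<lambda>s. \<Theta> s \<alpha> - \<Theta> s \<beta>) has_real_derivative \<omega> \<tau> \<alpha> - \<omega> \<tau> \<beta>) (at \<tau>)"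
            using \<tau> t \<alpha>\<beta> by (intro DERIV_diff deriv) auto
          ultimately show "\<exists>y. ((\<lambda>s. \<Theta> s \<alpha> - \<Theta> s \<beta>) has_real_derivative y) (at \<tau>) \<and> y < 0"
            by (intro exI[of _ "\<omega> \<tau> \<alpha> - \<omega> \<tau> \<beta>"]) auto
        next
          have "continuous_on {0..} (\<lambda>s. \<Theta> s \<alpha> - \<Theta> s \<beta>)"
            using \<alpha>\<beta> by (intro continuous_intros cont)
          then show "continuous_on {t..s} (\<lambda>s. \<Theta> s \<alpha> - \<Theta> s \<beta>)"
            by (rule continuous_on_subset) (use t in auto)
        qed
        then show ?thesis using ext by simp
      qed
      then show ?thesis using b(1) by (auto simp: eventually_at_right_field)
    qed
    then show "\<forall>\<^sub>F s in at_right t. \<forall>\<alpha>\<in>{1..N}. \<forall>\<beta>\<in>{1..N}. \<Theta> s \<alpha> - \<Theta> s \<beta> \<le> \<theta>s"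
      by (intro eventually_ball_finite ballI) auto
  qed (use init in auto)
  then show ?thesis using assms by blast
qed

section \<open>Synchronization of the velocities\<close>

text \<open>
  The response function is used only on the compact range of velocities, where the slopes 1 / F' of its
  inverse are bounded, bounded away from zero and Lipschitz as a function of the velocity. The
  final bound depends on F only through these three constants and F bG - F aG.
\<close>

locale velocity_response =
  fixes F :: "real \<Rightarrow> real" and aG bG m M l :: real
  assumes F_deriv: "\<And>\<xi>. \<xi> \<in> {aG..bG} \<Longrightarrow> (F has_real_derivative deriv F \<xi>) (at \<xi>)"
    and deriv_pos: "\<And>\<xi>. \<xi> \<in> {aG..bG} \<Longrightarrow> 0 < deriv F \<xi>"
    and m_pos: "0 < m"
    and slope_bounds: "\<And>\<xi>. \<xi> \<in> {aG..bG} \<Longrightarrow> 1 / deriv F \<xi> \<in> {m..M}"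
    and slope_lipschitz: "\<And>\<xi> w. \<xi> \<in> {aG..bG} \<Longrightarrow> w \<in> {aG..bG} \<Longrightarrow>
      \<bar>1 / deriv F \<xi> - 1 / deriv F w\<bar> \<le> l * \<bar>\<xi> - w\<bar>"
    and l_nonneg: "0 \<le> l"
begin

lemma Qinv_slope:
  assumes "x \<in> {aG..bG}" "y \<in> {aG..bG}"
  shows "Qinv F x y \<in> {m..M}" "x - y = Qinv F x y * (F x - F y)"
  using Qinv_mean_value[OF assms F_deriv deriv_pos] slope_bounds by metis+

lemma Qinv_near:
  assumes "x \<in> {aG..bG}" "y \<in> {aG..bG}" "w \<in> {aG..bG}" "\<bar>x - w\<bar> \<le> e" "\<bar>y - w\<bar> \<le> e"
  shows "\<bar>Qinv F x y - 1 / deriv F w\<bar> \<le> l * e"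
proof -
  obtain \<xi> where \<xi>: "\<xi> \<in> {aG..bG}" "min x y \<le> \<xi>" "\<xi> \<le> max x y" "Qinv F x y = 1 / deriv F \<xi>"
    using Qinv_mean_value[OF assms(1,2) F_deriv deriv_pos] by metis
  have "\<bar>\<xi> - w\<bar> \<le> e" using \<xi> assms by linarith
  then have "l * \<bar>\<xi> - w\<bar> \<le> l * e" using l_nonneg by (rule mult_left_mono)
  then show ?thesis using slope_lipschitz[OF \<xi>(1) assms(3)] \<xi>(4) by simp
qed

end

text \<open>
  A solution together with its velocities and the a priori bounds on velocities and phases; lemma
  GK_solution_is_flow shows that every solution in the theorem is of this form.
\<close>

locale GK_flow = velocity_response +
  fixes \<kappa> a\<Phi> b\<Phi> \<theta>s :: real and N :: nat and \<nu> :: "nat \<Rightarrow> real"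
    and \<phi> :: "nat \<Rightarrow> nat \<Rightarrow> real" and \<Theta> \<omega> :: "real \<Rightarrow> nat \<Rightarrow> real"
  assumes N: "1 \<le> N" and \<kappa>: "0 < \<kappa>" and a\<Phi>: "0 < a\<Phi>" and \<theta>s: "0 < \<theta>s" "\<theta>s < pi / 2"
    and \<phi>_sym: "\<And>\<alpha> \<beta>. \<alpha> \<in> {1..N} \<Longrightarrow> \<beta> \<in> {1..N} \<Longrightarrow> \<phi> \<alpha> \<beta> = \<phi> \<beta> \<alpha>"
    and \<phi>_bounds: "\<And>\<alpha> \<beta>. \<alpha> \<in> {1..N} \<Longrightarrow> \<beta> \<in> {1..N} \<Longrightarrow> \<phi> \<alpha> \<beta> \<in> {a\<Phi>..b\<Phi>}"
    and cont: "\<And>\<alpha>. \<alpha> \<in> {1..N} \<Longrightarrow> continuous_on {0..} (\<lambda>t. \<Theta> t \<alpha>)"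
    and deriv: "\<And>t \<alpha>. 0 < t \<Longrightarrow> \<alpha> \<in> {1..N} \<Longrightarrow> ((\<lambda>s. \<Theta> s \<alpha>) has_real_derivative \<omega> t \<alpha>) (at t)"
    and velocity: "\<And>t \<alpha>. 0 < t \<Longrightarrow> \<alpha> \<in> {1..N} \<Longrightarrow> \<omega> t \<alpha> \<in> {aG..bG}"
    and law: "\<And>t \<alpha>. 0 < t \<Longrightarrow> \<alpha> \<in> {1..N} \<Longrightarrow> F (\<omega> t \<alpha>) = \<nu> \<alpha> + coupling \<kappa> N \<phi> (\<Theta> t) \<alpha>"
    and \<nu>_bounds: "\<And>\<alpha>. \<alpha> \<in> {1..N} \<Longrightarrow> \<nu> \<alpha> \<in> {F aG + \<kappa> * b\<Phi>..F bG - \<kappa> * b\<Phi>}"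
    and phases: "\<And>t \<alpha> \<beta>. 0 \<le> t \<Longrightarrow> \<alpha> \<in> {1..N} \<Longrightarrow> \<beta> \<in> {1..N} \<Longrightarrow> \<Theta> t \<alpha> - \<Theta> t \<beta> \<le> \<theta>s"
begin

lemma phase_difference: "0 \<le> t \<Longrightarrow> \<alpha> \<in> {1..N} \<Longrightarrow> \<beta> \<in> {1..N} \<Longrightarrow> \<bar>\<Theta> t \<alpha> - \<Theta> t \<beta>\<bar> \<le> \<theta>s"
  using phases[of t \<alpha> \<beta>] phases[of t \<beta> \<alpha>] by (simp add: abs_le_iff)

lemma cos_\<theta>s_pos: "0 < cos \<theta>s"
  using \<theta>s by (intro cos_gt_zero_pi) auto

lemma \<nu>_mean_bounds:
  "(\<Sum>\<alpha>=1..N. \<nu> \<alpha>) / real N \<in> {F aG + \<kappa> * b\<Phi>..F bG - \<kappa> * b\<Phi>}"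
proof -
  have "real N * (F aG + \<kappa> * b\<Phi>) \<le> (\<Sum>\<alpha>=1..N. \<nu> \<alpha>)" "(\<Sum>\<alpha>=1..N. \<nu> \<alpha>) \<le> real N * (F bG - \<kappa> * b\<Phi>)"
    using sum_bounded_below[of "{1..N}" "F aG + \<kappa> * b\<Phi>" \<nu>]
      sum_bounded_above[of "{1..N}" \<nu> "F bG - \<kappa> * b\<Phi>"] \<nu>_bounds by auto
  then show ?thesis using N by (simp add: field_simps)
qed

text \<open>
  The right-hand side of the model, shifted by the mean natural frequency F w, solves a consensus
  equation: its time derivative contains velocity differences, which are slopes of the inverse of F
  times differences of the forces themselves. Antisymmetry of the sine keeps the mean at zero, so
  consensus_decay applies. The supremum norm is used because each velocity must be controlled by a
  bound that does not depend on N.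
\<close>

lemma velocity_synchronization:
  assumes w: "w \<in> {aG..bG}" "F w = (\<Sum>\<alpha>=1..N. \<nu> \<alpha>) / real N"
    and t: "0 < t" and \<alpha>: "\<alpha> \<in> {1..N}"
  shows "\<bar>\<omega> t \<alpha> - w\<bar> \<le> M * ((F bG - F aG) * exp (- (\<kappa> * a\<Phi> * cos \<theta>s * m) * t))"
proof -
  define y where "y t \<alpha> = \<nu> \<alpha> + coupling \<kappa> N \<phi> (\<Theta> t) \<alpha> - F w" for t \<alpha>
  define W where "W t \<alpha> \<beta> = \<kappa> / real N * \<phi> \<alpha> \<beta> * cos (\<Theta> t \<beta> - \<Theta> t \<alpha>) * Qinv F (\<omega> t \<beta>) (\<omega> t \<alpha>)"
    for t \<alpha> \<beta>
  have y_law: "y t \<alpha> = F (\<omega> t \<alpha>) - F w" if "0 < t" "\<alpha> \<in> {1..N}" for t \<alpha>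
    using law[OF that] by (simp add: y_def)
  have "vec_norm \<infinity> N (y t) \<le> vec_norm \<infinity> N (y 0) * exp (- (\<kappa> * a\<Phi> * cos \<theta>s * m) * t)"
  proof (rule consensus_decay[where W = W and b = "\<kappa> * b\<Phi> * M"])
    show "continuous_on {0..} (\<lambda>t. y t \<alpha>)" if "\<alpha> \<in> {1..N}" for \<alpha>
      unfolding y_def using that by (intro continuous_intros continuous_on_coupling cont)
    fix t :: real and \<alpha> assume t: "0 < t" and \<alpha>: "\<alpha> \<in> {1..N}"
    have "((\<lambda>s. coupling \<kappa> N \<phi> (\<Theta> s) \<alpha>) has_real_derivative
        (\<Sum>\<beta>=1..N. \<kappa> / real N * \<phi> \<alpha> \<beta> * cos (\<Theta> t \<beta> - \<Theta> t \<alpha>) * (\<omega> t \<beta> - \<omega> t \<alpha>))) (at t)"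
      by (intro coupling_has_derivative deriv[OF t] \<alpha>)
    also have "(\<Sum>\<beta>=1..N. \<kappa> / real N * \<phi> \<alpha> \<beta> * cos (\<Theta> t \<beta> - \<Theta> t \<alpha>) * (\<omega> t \<beta> - \<omega> t \<alpha>))
        = (\<Sum>\<beta>=1..N. W t \<alpha> \<beta> * (y t \<beta> - y t \<alpha>))"
    proof (rule sum.cong[OF refl])
      fix \<beta> assume \<beta>: "\<beta> \<in> {1..N}"
      have "\<omega> t \<beta> - \<omega> t \<alpha> = Qinv F (\<omega> t \<beta>) (\<omega> t \<alpha>) * (y t \<beta> - y t \<alpha>)"
        using Qinv_slope(2)[OF velocity[OF t \<beta>] velocity[OF t \<alpha>]] y_law[OF t \<alpha>] y_law[OF t \<beta>] by simp
      then show "\<kappa> / real N * \<phi> \<alpha> \<beta> * cos (\<Theta> t \<beta> - \<Theta> t \<alpha>) * (\<omega> t \<beta> - \<omega> t \<alpha>)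
          = W t \<alpha> \<beta> * (y t \<beta> - y t \<alpha>)" by (simp add: W_def)
    qed
    finally show "((\<lambda>s. y s \<alpha>) has_real_derivative (\<Sum>\<beta>=1..N. W t \<alpha> \<beta> * (y t \<beta> - y t \<alpha>))) (at t)"
      unfolding y_def by (auto intro!: derivative_eq_intros)
  next
    fix t :: real and \<alpha> \<beta> assume t: "0 < t" and \<alpha>: "\<alpha> \<in> {1..N}" and \<beta>: "\<beta> \<in> {1..N}"
    have "cos (\<Theta> t \<beta> - \<Theta> t \<alpha>) = cos (\<Theta> t \<alpha> - \<Theta> t \<beta>)"
      using cos_minus[of "\<Theta> t \<alpha> - \<Theta> t \<beta>"] by simp
    then show "W t \<alpha> \<beta> = W t \<beta> \<alpha>"
      unfolding W_def using \<phi>_sym[OF \<alpha> \<beta>] Qinv_commute[of F "\<omega> t \<alpha>" "\<omega> t \<beta>"] by simp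
    have "cos \<theta>s \<le> cos \<bar>\<Theta> t \<beta> - \<Theta> t \<alpha>\<bar>"
      using \<theta>s phase_difference[of t \<beta> \<alpha>] t \<alpha> \<beta> by (intro cos_monotone_0_pi_le) auto
    then have cos: "cos \<theta>s \<le> cos (\<Theta> t \<beta> - \<Theta> t \<alpha>)" by simp
    have Q: "m \<le> Qinv F (\<omega> t \<beta>) (\<omega> t \<alpha>)" "Qinv F (\<omega> t \<beta>) (\<omega> t \<alpha>) \<le> M"
      using Qinv_slope(1)[OF velocity[OF t \<beta>] velocity[OF t \<alpha>]] by auto
    have \<phi>: "a\<Phi> \<le> \<phi> \<alpha> \<beta>" "\<phi> \<alpha> \<beta> \<le> b\<Phi>" using \<phi>_bounds[OF \<alpha> \<beta>] by auto
    have "a\<Phi> * cos \<theta>s * m \<le> \<phi> \<alpha> \<beta> * cos (\<Theta> t \<beta> - \<Theta> t \<alpha>) * Qinv F (\<omega> t \<beta>) (\<omega> t \<alpha>)"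
      and "\<phi> \<alpha> \<beta> * cos (\<Theta> t \<beta> - \<Theta> t \<alpha>) * Qinv F (\<omega> t \<beta>) (\<omega> t \<alpha>) \<le> b\<Phi> * 1 * M"
      using \<phi> Q cos cos_\<theta>s_pos a\<Phi> m_pos cos_le_one[of "\<Theta> t \<beta> - \<Theta> t \<alpha>"]
      by (intro mult_mono mult_nonneg_nonneg; linarith)+
    then have "\<kappa> / real N * (a\<Phi> * cos \<theta>s * m) \<le> W t \<alpha> \<beta>" "W t \<alpha> \<beta> \<le> \<kappa> / real N * (b\<Phi> * 1 * M)"
      unfolding W_def mult.assoc[of "\<kappa> / real N"] mult.assoc[of "\<kappa> / real N * _"] using \<kappa>
      by (simp_all add: mult_left_mono divide_right_mono mult.assoc)
    then show "W t \<alpha> \<beta> \<in> {\<kappa> * a\<Phi> * cos \<theta>s * m / real N..\<kappa> * b\<Phi> * M / real N}"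
      by (simp add: mult.assoc)
  next
    fix t :: real
    show "(\<Sum>\<alpha>=1..N. y t \<alpha>) = 0"
      using sum_coupling_eq_0[OF \<phi>_sym, where \<kappa> = \<kappa> and \<theta> = "\<Theta> t"] w(2) N
      by (simp add: y_def sum.distrib sum_subtractf)
  qed (use N t \<kappa> a\<Phi> cos_\<theta>s_pos m_pos in auto)
  also have "\<dots> \<le> (F bG - F aG) * exp (- (\<kappa> * a\<Phi> * cos \<theta>s * m) * t)"
  proof (rule mult_right_mono)
    have "\<bar>y 0 \<beta>\<bar> \<le> F bG - F aG" if "\<beta> \<in> {1..N}" for \<beta>
    proof -
      have "\<bar>\<phi> \<beta> \<gamma>\<bar> \<le> b\<Phi>" if "\<gamma> \<in> {1..N}" for \<gamma>
        using \<phi>_bounds[OF \<open>\<beta> \<in> {1..N}\<close> that] a\<Phi> by (simp add: abs_le_iff)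
      then have "\<bar>coupling \<kappa> N \<phi> (\<Theta> 0) \<beta>\<bar> \<le> \<kappa> * b\<Phi>"
        using \<kappa> by (intro coupling_bound[OF N]) auto
      moreover have "0 < \<kappa> * b\<Phi>"
        using \<kappa> a\<Phi> \<phi>_bounds[OF that that] by (intro mult_pos_pos) auto
      ultimately show ?thesis
        using \<nu>_bounds[OF that] \<nu>_mean_bounds w(2) unfolding y_def atLeastAtMost_iff by linarith
    qed
    then show "vec_norm \<infinity> N (y 0) \<le> F bG - F aG" using vec_norm_infinity_le_iff[OF N] by blast
  qed simp
  finally have "\<bar>y t \<alpha>\<bar> \<le> (F bG - F aG) * exp (- (\<kappa> * a\<Phi> * cos \<theta>s * m) * t)"
    using vec_norm_infinity_le_iff[OF N] \<alpha> by blast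
  moreover have "\<omega> t \<alpha> - w = Qinv F (\<omega> t \<alpha>) w * y t \<alpha>" and Q: "Qinv F (\<omega> t \<alpha>) w \<in> {m..M}"
    using Qinv_slope[OF velocity[OF t \<alpha>] w(1)] y_law[OF t \<alpha>] by auto
  ultimately show ?thesis using m_pos by (auto simp: abs_mult intro!: mult_mono)
qed

end

section \<open>Comparison of two flows\<close>

text \<open>
  The difference of the flows is an instance of perturbed_consensus_bound. The difference of the
  coupling terms is split so that the phase differences carry the first communication matrix, which
  is symmetric, and the difference of the matrices carries the second flow, which makes it a source of
  zero sum.
\<close>

lemma GK_flows_stability:
  assumes flow: "GK_flow F aG bG m M l \<kappa> a\<Phi> b\<Phi> \<theta>s N \<nu> \<phi> \<Theta> \<omega>"
    and flow': "GK_flow F aG bG m M l \<kappa> a\<Phi> b\<Phi> \<theta>s N \<nu>' \<phi>' \<Theta>' \<omega>'"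
    and same_mean: "(\<Sum>\<alpha>=1..N. \<nu> \<alpha>) = (\<Sum>\<alpha>=1..N. \<nu>' \<alpha>)"
    and aG_bG: "aG < bG" and p: "1 \<le> p" and t: "0 \<le> t"
  defines "r \<equiv> \<kappa> * a\<Phi> * cos \<theta>s" and "b \<equiv> \<kappa> * b\<Phi>"
    and "A \<equiv> vec_norm p N (\<lambda>\<alpha>. \<nu> \<alpha> - \<nu>' \<alpha>)
      + \<kappa> * (mat_norm p N (\<lambda>\<alpha> \<beta>. \<phi> \<alpha> \<beta> - \<phi>' \<alpha> \<beta>) / real N powr real_of_ereal (1 / p))"
  shows "vec_norm p N (\<lambda>\<alpha>. \<Theta> t \<alpha> - \<Theta>' t \<alpha>)
    \<le> (vec_norm p N (\<lambda>\<alpha>. \<Theta> 0 \<alpha> - \<Theta>' 0 \<alpha>) + A / r + A / (2 * b))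
      * exp (2 * b * (l * (M * (F bG - F aG))) / (r * m))"
proof -
  interpret A: GK_flow F aG bG m M l \<kappa> a\<Phi> b\<Phi> \<theta>s N \<nu> \<phi> \<Theta> \<omega> by (rule flow)
  interpret B: GK_flow F aG bG m M l \<kappa> a\<Phi> b\<Phi> \<theta>s N \<nu>' \<phi>' \<Theta>' \<omega>' by (rule flow')
  note N = A.N
  define \<nu>m where "\<nu>m = (\<Sum>\<alpha>=1..N. \<nu> \<alpha>) / real N"
  have "0 < b\<Phi>" using A.\<phi>_bounds[of 1 1] A.a\<Phi> N by auto
  then have b: "0 < b" using A.\<kappa> by (simp add: b_def)
  have r: "0 < r" using A.\<kappa> A.a\<Phi> A.cos_\<theta>s_pos by (simp add: r_def)
  \<comment> \<open>w is the common limit of all velocities of both flows\<close>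
  have "continuous_on {aG..bG} F"
    using A.F_deriv by (intro continuous_at_imp_continuous_on ballI) (metis DERIV_isCont)
  then obtain w where w: "w \<in> {aG..bG}" "F w = \<nu>m"
    using IVT'[of F aG \<nu>m bG] A.\<nu>_mean_bounds b aG_bG by (auto simp: \<nu>m_def b_def)
  define d where "d t \<alpha> \<beta> = \<Theta> t \<beta> - \<Theta> t \<alpha>" for t \<alpha> \<beta>
  define d' where "d' t \<alpha> \<beta> = \<Theta>' t \<beta> - \<Theta>' t \<alpha>" for t \<alpha> \<beta>
  define c where "c t \<alpha> = Qinv F (\<omega> t \<alpha>) (\<omega>' t \<alpha>)" for t \<alpha>
  define W where "W t \<alpha> \<beta> = \<kappa> / real N * (\<phi> \<alpha> \<beta> * (1 / Qinv sin (d t \<alpha> \<beta>) (d' t \<alpha> \<beta>)))" for t \<alpha> \<beta>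
  define f where "f t \<alpha> = \<nu> \<alpha> - \<nu>' \<alpha> + coupling \<kappa> N (\<lambda>\<alpha> \<beta>. \<phi> \<alpha> \<beta> - \<phi>' \<alpha> \<beta>) (\<Theta>' t) \<alpha>" for t \<alpha>
  have dd: "\<bar>d t \<alpha> \<beta>\<bar> \<le> \<theta>s" "\<bar>d' t \<alpha> \<beta>\<bar> \<le> \<theta>s" if "0 < t" "\<alpha> \<in> {1..N}" "\<beta> \<in> {1..N}" for t \<alpha> \<beta>
    using that A.phase_difference B.phase_difference by (auto simp: d_def d'_def)
  have "vec_norm p N (\<lambda>\<alpha>. \<Theta> t \<alpha> - \<Theta>' t \<alpha>)
    \<le> (vec_norm p N (\<lambda>\<alpha>. \<Theta> 0 \<alpha> - \<Theta>' 0 \<alpha>) + A / r + A / (2 * b))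
      * exp (2 * b * (l * (M * (F bG - F aG))) / (r * m))"
  proof (rule perturbed_consensus_bound[where c = c and f = f and W = W and ?c0.0 = "1 / deriv F w", OF p N])
    show "continuous_on {0..} (\<lambda>t. \<Theta> t \<alpha> - \<Theta>' t \<alpha>)" if "\<alpha> \<in> {1..N}" for \<alpha>
      using that by (intro continuous_intros A.cont B.cont)
  next
    fix t :: real and \<alpha> assume t: "0 < t" and \<alpha>: "\<alpha> \<in> {1..N}"
    have "coupling \<kappa> N \<phi> (\<Theta> t) \<alpha> - coupling \<kappa> N \<phi>' (\<Theta>' t) \<alpha>
        = coupling \<kappa> N (\<lambda>\<alpha> \<beta>. \<phi> \<alpha> \<beta> - \<phi>' \<alpha> \<beta>) (\<Theta>' t) \<alpha>
          + \<kappa> / real N * (\<Sum>\<beta>=1..N. \<phi> \<alpha> \<beta> * (sin (d t \<alpha> \<beta>) - sin (d' t \<alpha> \<beta>)))"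
      by (simp add: coupling_def d_def d'_def left_diff_distrib right_diff_distrib sum_subtractf
          diff_divide_distrib)
    also have "\<kappa> / real N * (\<Sum>\<beta>=1..N. \<phi> \<alpha> \<beta> * (sin (d t \<alpha> \<beta>) - sin (d' t \<alpha> \<beta>)))
        = (\<Sum>\<beta>=1..N. W t \<alpha> \<beta> * ((\<Theta> t \<beta> - \<Theta>' t \<beta>) - (\<Theta> t \<alpha> - \<Theta>' t \<alpha>)))"
      unfolding sum_distrib_left
    proof (rule sum.cong[OF refl])
      fix \<beta> assume \<beta>: "\<beta> \<in> {1..N}"
      have "sin (d t \<alpha> \<beta>) - sin (d' t \<alpha> \<beta>)
          = 1 / Qinv sin (d t \<alpha> \<beta>) (d' t \<alpha> \<beta>) * (d t \<alpha> \<beta> - d' t \<alpha> \<beta>)"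
        by (rule Qinv_sin(2)[OF dd[OF t \<alpha> \<beta>] A.\<theta>s(2)])
      moreover have "d t \<alpha> \<beta> - d' t \<alpha> \<beta> = (\<Theta> t \<beta> - \<Theta>' t \<beta>) - (\<Theta> t \<alpha> - \<Theta>' t \<alpha>)"
        by (simp add: d_def d'_def)
      ultimately show "\<kappa> / real N * (\<phi> \<alpha> \<beta> * (sin (d t \<alpha> \<beta>) - sin (d' t \<alpha> \<beta>)))
          = W t \<alpha> \<beta> * ((\<Theta> t \<beta> - \<Theta>' t \<beta>) - (\<Theta> t \<alpha> - \<Theta>' t \<alpha>))"
        by (simp add: W_def)
    qed
    finally have "F (\<omega> t \<alpha>) - F (\<omega>' t \<alpha>)
        = f t \<alpha> + (\<Sum>\<beta>=1..N. W t \<alpha> \<beta> * ((\<Theta> t \<beta> - \<Theta>' t \<beta>) - (\<Theta> t \<alpha> - \<Theta>' t \<alpha>)))"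
      using A.law[OF t \<alpha>] B.law[OF t \<alpha>] by (simp add: f_def)
    then have "\<omega> t \<alpha> - \<omega>' t \<alpha> = c t \<alpha> *
        (f t \<alpha> + (\<Sum>\<beta>=1..N. W t \<alpha> \<beta> * ((\<Theta> t \<beta> - \<Theta>' t \<beta>) - (\<Theta> t \<alpha> - \<Theta>' t \<alpha>))))"
      using A.Qinv_slope(2)[OF A.velocity[OF t \<alpha>] B.velocity[OF t \<alpha>]] by (simp add: c_def)
    then show "((\<lambda>s. \<Theta> s \<alpha> - \<Theta>' s \<alpha>) has_real_derivative c t \<alpha> *
        (f t \<alpha> + (\<Sum>\<beta>=1..N. W t \<alpha> \<beta> * ((\<Theta> t \<beta> - \<Theta>' t \<beta>) - (\<Theta> t \<alpha> - \<Theta>' t \<alpha>))))) (at t)"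
      using DERIV_diff[OF A.deriv[OF t \<alpha>] B.deriv[OF t \<alpha>]] by simp
    have "\<bar>\<omega> t \<alpha> - w\<bar> \<le> M * ((F bG - F aG) * exp (- (r * m) * t))"
      unfolding r_def by (rule A.velocity_synchronization[OF w(1) _ t \<alpha>]) (simp add: w(2) \<nu>m_def)
    moreover have "\<bar>\<omega>' t \<alpha> - w\<bar> \<le> M * ((F bG - F aG) * exp (- (r * m) * t))"
      unfolding r_def by (rule B.velocity_synchronization[OF w(1) _ t \<alpha>])
        (use w(2) same_mean in \<open>simp add: \<nu>m_def\<close>)
    ultimately have "\<bar>c t \<alpha> - 1 / deriv F w\<bar> \<le> l * (M * ((F bG - F aG) * exp (- (r * m) * t)))"
      unfolding c_def by (intro A.Qinv_near A.velocity[OF t \<alpha>] B.velocity[OF t \<alpha>] w(1))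
    then show "\<bar>c t \<alpha> - 1 / deriv F w\<bar> \<le> l * (M * (F bG - F aG)) * exp (- (r * m) * t)"
      by (simp add: mult.assoc)
  next
    fix t :: real and \<alpha> \<beta> assume t: "0 < t" and \<alpha>: "\<alpha> \<in> {1..N}" and \<beta>: "\<beta> \<in> {1..N}"
    have "Qinv sin (d t \<beta> \<alpha>) (d' t \<beta> \<alpha>) = Qinv sin (d t \<alpha> \<beta>) (d' t \<alpha> \<beta>)"
      using Qinv_sin_minus[of "d t \<alpha> \<beta>" "d' t \<alpha> \<beta>"] by (simp add: d_def d'_def)
    then show "W t \<alpha> \<beta> = W t \<beta> \<alpha>" using A.\<phi>_sym[OF \<alpha> \<beta>] by (simp add: W_def)
    have Q: "cos \<theta>s \<le> 1 / Qinv sin (d t \<alpha> \<beta>) (d' t \<alpha> \<beta>)" "1 / Qinv sin (d t \<alpha> \<beta>) (d' t \<alpha> \<beta>) \<le> 1"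
      using Qinv_sin(1)[OF dd[OF t \<alpha> \<beta>] A.\<theta>s(2)] by auto
    have \<phi>: "a\<Phi> \<le> \<phi> \<alpha> \<beta>" "\<phi> \<alpha> \<beta> \<le> b\<Phi>" using A.\<phi>_bounds[OF \<alpha> \<beta>] by auto
    have "a\<Phi> * cos \<theta>s \<le> \<phi> \<alpha> \<beta> * (1 / Qinv sin (d t \<alpha> \<beta>) (d' t \<alpha> \<beta>))"
      and "\<phi> \<alpha> \<beta> * (1 / Qinv sin (d t \<alpha> \<beta>) (d' t \<alpha> \<beta>)) \<le> b\<Phi> * 1"
      using \<phi> Q A.a\<Phi> A.cos_\<theta>s_pos by (intro mult_mono; linarith)+
    then have "\<kappa> / real N * (a\<Phi> * cos \<theta>s) \<le> W t \<alpha> \<beta>" "W t \<alpha> \<beta> \<le> \<kappa> / real N * (b\<Phi> * 1)"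
      unfolding W_def using A.\<kappa> by (intro mult_left_mono; simp)+
    then show "W t \<alpha> \<beta> \<in> {r / real N..b / real N}" by (simp add: r_def b_def mult.assoc)
  next
    fix t :: real assume t: "0 < t"
    show "(\<Sum>\<alpha>=1..N. f t \<alpha>) = 0"
      using sum_coupling_eq_0[of N "\<lambda>\<alpha> \<beta>. \<phi> \<alpha> \<beta> - \<phi>' \<alpha> \<beta>" \<kappa> "\<Theta>' t"] A.\<phi>_sym B.\<phi>_sym same_mean
      by (simp add: f_def sum.distrib sum_subtractf)
    have "vec_norm p N (f t) \<le> vec_norm p N (\<lambda>\<alpha>. \<nu> \<alpha> - \<nu>' \<alpha>)
        + vec_norm p N (coupling \<kappa> N (\<lambda>\<alpha> \<beta>. \<phi> \<alpha> \<beta> - \<phi>' \<alpha> \<beta>) (\<Theta>' t))"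
      unfolding f_def by (rule vec_norm_triangle[OF p N])
    also have "vec_norm p N (coupling \<kappa> N (\<lambda>\<alpha> \<beta>. \<phi> \<alpha> \<beta> - \<phi>' \<alpha> \<beta>) (\<Theta>' t))
        \<le> vec_norm p N (\<lambda>\<alpha>. \<kappa> * ((\<Sum>\<beta>=1..N. \<bar>\<phi> \<alpha> \<beta> - \<phi>' \<alpha> \<beta>\<bar>) / real N))"
    proof (rule vec_norm_mono[OF p N])
      fix \<alpha>
      have "\<bar>\<Sum>\<beta>=1..N. (\<phi> \<alpha> \<beta> - \<phi>' \<alpha> \<beta>) * sin (\<Theta>' t \<beta> - \<Theta>' t \<alpha>)\<bar> \<le> (\<Sum>\<beta>=1..N. \<bar>\<phi> \<alpha> \<beta> - \<phi>' \<alpha> \<beta>\<bar>)"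
        by (rule order_trans[OF sum_abs]) (auto simp: abs_mult intro!: sum_mono mult_left_le)
      then show "\<bar>coupling \<kappa> N (\<lambda>\<alpha> \<beta>. \<phi> \<alpha> \<beta> - \<phi>' \<alpha> \<beta>) (\<Theta>' t) \<alpha>\<bar>
          \<le> \<bar>\<kappa> * ((\<Sum>\<beta>=1..N. \<bar>\<phi> \<alpha> \<beta> - \<phi>' \<alpha> \<beta>\<bar>) / real N)\<bar>"
        using A.\<kappa> N by (simp add: coupling_def abs_mult divide_right_mono mult_left_mono sum_nonneg)
    qed
    also have "\<dots> \<le> \<bar>\<kappa>\<bar> * vec_norm p N (\<lambda>\<alpha>. (\<Sum>\<beta>=1..N. \<bar>\<phi> \<alpha> \<beta> - \<phi>' \<alpha> \<beta>\<bar>) / real N)"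
      by (rule vec_norm_scale[OF p N])
    also have "\<dots> \<le> \<bar>\<kappa>\<bar> * (mat_norm p N (\<lambda>\<alpha> \<beta>. \<phi> \<alpha> \<beta> - \<phi>' \<alpha> \<beta>) / real N powr real_of_ereal (1 / p))"
      by (intro mult_left_mono vec_norm_row_average[OF p N]) simp
    finally show "vec_norm p N (f t) \<le> A" using A.\<kappa> by (simp add: A_def)
  qed (use r A.m_pos A.deriv_pos[OF w(1)] t in auto)
  then show ?thesis .
qed

section \<open>From solutions to flows\<close>

text \<open>
  Twice continuous differentiability of F provides the Lipschitz constant: it is the maximum of the
  absolute derivative of 1 / F' over the range.
\<close>

lemma velocity_response_exists:
  assumes aG_bG: "aG < bG" and sub: "{aG..bG} \<subseteq> S"
    and F: "F C1_differentiable_on S" and F': "deriv F C1_differentiable_on S"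
    and pos: "\<forall>\<theta>\<in>S. deriv F \<theta> > 0"
  obtains m M l where "velocity_response F aG bG m M l"
proof -
  define g where "g x = 1 / deriv F x" for x
  have dF: "(F has_real_derivative deriv F x) (at x)" if x: "x \<in> S" for x
  proof -
    obtain D where "(F has_real_derivative D) (at x)"
      using x F by (auto simp: C1_differentiable_on_def has_real_derivative_iff_has_vector_derivative)
    then show ?thesis using DERIV_imp_deriv by metis
  qed
  obtain D where D: "\<And>x. x \<in> S \<Longrightarrow> (deriv F has_real_derivative D x) (at x)" "continuous_on S D"
    using F' by (auto simp: C1_differentiable_on_def has_real_derivative_iff_has_vector_derivative)
  have cont': "continuous_on {aG..bG} (deriv F)"
    using sub D(1) by (intro continuous_at_imp_continuous_on ballI) (metis DERIV_isCont subsetD)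
  have nz: "\<forall>x\<in>{aG..bG}. deriv F x \<noteq> 0" using pos sub by force
  have contg: "continuous_on {aG..bG} g"
    unfolding g_def using nz by (intro continuous_intros cont')
  have compact: "compact {aG..bG}" "{aG..bG} \<noteq> {}" using aG_bG by auto
  obtain u where u: "u \<in> {aG..bG}" "\<forall>x\<in>{aG..bG}. g u \<le> g x"
    using continuous_attains_inf[OF compact contg] by blast
  obtain v where v: "v \<in> {aG..bG}" "\<forall>x\<in>{aG..bG}. g x \<le> g v"
    using continuous_attains_sup[OF compact contg] by blast
  define g' where "g' x = - D x / (deriv F x)\<^sup>2" for x
  have dg: "(g has_real_derivative g' x) (at x)" if "x \<in> {aG..bG}" for x
    unfolding g_def g'_def using that sub nz D(1)
    by (auto intro!: derivative_eq_intros simp: power2_eq_square)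
  have "continuous_on {aG..bG} (\<lambda>x. \<bar>g' x\<bar>)"
    unfolding g'_def using nz by (intro continuous_intros cont' continuous_on_subset[OF D(2) sub]) auto
  then obtain k where k: "k \<in> {aG..bG}" "\<forall>x\<in>{aG..bG}. \<bar>g' x\<bar> \<le> \<bar>g' k\<bar>"
    using continuous_attains_sup[OF compact] by blast
  have "velocity_response F aG bG (g u) (g v) \<bar>g' k\<bar>"
  proof
    fix \<xi> assume \<xi>: "\<xi> \<in> {aG..bG}"
    show "(F has_real_derivative deriv F \<xi>) (at \<xi>)" using dF sub \<xi> by blast
    show "0 < deriv F \<xi>" using pos sub \<xi> by blast
    show "1 / deriv F \<xi> \<in> {g u..g v}" using u(2) v(2) \<xi> by (auto simp: g_def)
    fix w assume w: "w \<in> {aG..bG}"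
    have "norm (g \<xi> - g w) \<le> \<bar>g' k\<bar> * norm (\<xi> - w)"
      by (rule field_differentiable_bound[of "{aG..bG}" g g'])
        (use k(2) \<xi> w in \<open>auto intro: has_field_derivative_at_within[OF dg]\<close>)
    then show "\<bar>1 / deriv F \<xi> - 1 / deriv F w\<bar> \<le> \<bar>g' k\<bar> * \<bar>\<xi> - w\<bar>" by (simp add: g_def)
  next
    show "0 < g u" using pos sub u(1) by (auto simp: g_def)
  qed simp
  then show thesis by (rule that)
qed

lemma einterval_interval_subset:
  assumes "x \<in> einterval a b" "y \<in> einterval a b"
  shows "{x..y} \<subseteq> einterval a b"
proof
  fix z assume "z \<in> {x..y}"
  then show "z \<in> einterval a b"
    using assms by (auto simp: einterval_def intro: less_le_trans[of a "ereal x"] le_less_trans[of _ "ereal y"])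
qed

lemma strict_mono_on_einterval:
  assumes F: "F C1_differentiable_on einterval a b" and pos: "\<forall>x\<in>einterval a b. deriv F x > 0"
  shows "strict_mono_on (einterval a b) F"
proof (rule strict_mono_onI)
  fix x y assume xy: "x \<in> einterval a b" "y \<in> einterval a b" "x < y"
  show "F x < F y"
  proof (rule DERIV_pos_imp_increasing[OF xy(3)])
    fix z assume "x \<le> z" "z \<le> y"
    then have z: "z \<in> einterval a b" using einterval_interval_subset[OF xy(1,2)] by auto
    then obtain D where D: "(F has_real_derivative D) (at z)"
      using F by (auto simp: C1_differentiable_on_def has_real_derivative_iff_has_vector_derivative)
    then have "0 < D" using pos z DERIV_imp_deriv[OF D] by auto
    then show "\<exists>y. (F has_real_derivative y) (at z) \<and> 0 < y" using D by blast
  qed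
qed

lemma diff_le_diam:
  assumes "\<alpha> \<in> {1..N}" "\<beta> \<in> {1..N}"
  shows "x \<alpha> - x \<beta> \<le> diam N x"
proof -
  have "x \<alpha> \<le> (MAX \<alpha>\<in>{1..N}. x \<alpha>)" "(MIN \<alpha>\<in>{1..N}. x \<alpha>) \<le> x \<beta>"
    using assms by (auto intro!: Max_ge Min_le)
  then show ?thesis by (simp add: diam_def)
qed

lemma min_entry_le:
  assumes "\<alpha> \<in> {1..N}" "\<beta> \<in> {1..N}"
  shows "min_entry N \<phi> \<le> \<phi> \<alpha> \<beta>"
  using assms by (auto simp: min_entry_def intro!: Min_le rev_image_eqI[of "(\<alpha>, \<beta>)"])

lemma min_entry_pos:
  assumes "1 \<le> N" "comm_matrix N \<phi>"
  shows "0 < min_entry N \<phi>"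
  using assms by (auto simp: min_entry_def comm_matrix_def)

lemma GK_solution_is_flow:
  assumes response: "velocity_response F aG bG m M l"
    and mono: "strict_mono_on (einterval (- L) L) F"
    and sub: "aG \<in> einterval (- L) L" "bG \<in> einterval (- L) L"
    and N: "1 \<le> N" and \<kappa>: "0 < \<kappa>" and a\<Phi>: "0 < a\<Phi>" and \<theta>s: "0 < \<theta>s" "\<theta>s < pi / 2"
    and comm: "comm_matrix N \<phi>"
    and \<phi>: "\<And>\<alpha> \<beta>. \<alpha> \<in> {1..N} \<Longrightarrow> \<beta> \<in> {1..N} \<Longrightarrow> \<phi> \<alpha> \<beta> \<in> {a\<Phi>..b\<Phi>}"
    and diam: "diam N \<Theta>0 \<le> \<theta>s" and \<kappa>_large: "diam N \<nu> / (min_entry N \<phi> * sin \<theta>s) < \<kappa>"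
    and \<nu>: "\<And>\<alpha>. \<alpha> \<in> {1..N} \<Longrightarrow> \<nu> \<alpha> \<in> {F aG + \<kappa> * b\<Phi>..F bG - \<kappa> * b\<Phi>}"
    and sol: "GK_solution L F \<kappa> N \<Theta>0 \<nu> \<phi> \<Theta>"
  obtains \<omega> where "GK_flow F aG bG m M l \<kappa> a\<Phi> b\<Phi> \<theta>s N \<nu> \<phi> \<Theta> \<omega>"
proof -
  let ?I = "einterval (- L) L"
  have init: "\<Theta> 0 \<alpha> = \<Theta>0 \<alpha>" and cont: "continuous_on {0..} (\<lambda>t. \<Theta> t \<alpha>)" if "\<alpha> \<in> {1..N}" for \<alpha>
    using sol that by (auto simp: GK_solution_def)
  have "\<forall>t \<alpha>. \<exists>\<omega>. 0 < t \<longrightarrow> \<alpha> \<in> {1..N} \<longrightarrow> ((\<lambda>s. \<Theta> s \<alpha>) has_real_derivative \<omega>) (at t) \<and>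
      \<omega> \<in> ?I \<and> F \<omega> = \<nu> \<alpha> + coupling \<kappa> N \<phi> (\<Theta> t) \<alpha>"
    using sol unfolding GK_solution_def coupling_def by blast
  then obtain \<omega> where \<omega>: "\<And>t \<alpha>. 0 < t \<Longrightarrow> \<alpha> \<in> {1..N} \<Longrightarrow>
      ((\<lambda>s. \<Theta> s \<alpha>) has_real_derivative \<omega> t \<alpha>) (at t) \<and>
      \<omega> t \<alpha> \<in> ?I \<and> F (\<omega> t \<alpha>) = \<nu> \<alpha> + coupling \<kappa> N \<phi> (\<Theta> t) \<alpha>"
    by metis
  have F_le: "F x \<le> F y \<longleftrightarrow> x \<le> y" if "x \<in> ?I" "y \<in> ?I" for x y
    using strict_mono_on_leD[OF mono] strict_mono_onD[OF mono] that by (meson linorder_not_le)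
  have velocity: "\<omega> t \<alpha> \<in> {aG..bG}" if t: "0 < t" and \<alpha>: "\<alpha> \<in> {1..N}" for t \<alpha>
  proof -
    have "\<bar>\<phi> \<alpha> \<beta>\<bar> \<le> b\<Phi>" if "\<beta> \<in> {1..N}" for \<beta>
      using \<phi>[OF \<alpha> that] a\<Phi> by (simp add: abs_le_iff)
    then have "\<bar>coupling \<kappa> N \<phi> (\<Theta> t) \<alpha>\<bar> \<le> \<kappa> * b\<Phi>"
      using \<kappa> by (intro coupling_bound[OF N]) auto
    then have "F aG \<le> F (\<omega> t \<alpha>)" "F (\<omega> t \<alpha>) \<le> F bG"
      using \<omega>[OF t \<alpha>] \<nu>[OF \<alpha>] by (auto simp: abs_le_iff)
    then show ?thesis
      using F_le[of aG "\<omega> t \<alpha>"] F_le[of "\<omega> t \<alpha>" bG] \<omega>[OF t \<alpha>] sub by simp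
  qed
  have sin_pos: "0 < sin \<theta>s" using \<theta>s by (intro sin_gt_zero) auto
  have phases: "\<Theta> t \<alpha> - \<Theta> t \<beta> \<le> \<theta>s" if "0 \<le> t" "\<alpha> \<in> {1..N}" "\<beta> \<in> {1..N}" for t \<alpha> \<beta>
  proof (rule phase_diameter_invariant[where \<omega> = \<omega> and \<nu> = \<nu>, OF N _ _ min_entry_le cont _ _ \<theta>s(2) _ _ that])
    show "0 \<le> \<kappa>" "0 \<le> min_entry N \<phi>" using \<kappa> min_entry_pos[OF N comm] by auto
    show "((\<lambda>s. \<Theta> s \<alpha>) has_real_derivative \<omega> t \<alpha>) (at t)" if "0 < t" "\<alpha> \<in> {1..N}" for t \<alpha>
      using \<omega>[OF that] by simp
    show "\<omega> t \<alpha> < \<omega> t \<beta>" if "0 < t" "\<alpha> \<in> {1..N}" "\<beta> \<in> {1..N}"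
      "\<nu> \<alpha> + coupling \<kappa> N \<phi> (\<Theta> t) \<alpha> < \<nu> \<beta> + coupling \<kappa> N \<phi> (\<Theta> t) \<beta>" for t \<alpha> \<beta>
      using \<omega>[OF that(1,2)] \<omega>[OF that(1,3)] that(4) F_le by (metis linorder_not_le)
    show "\<nu> \<alpha> - \<nu> \<beta> < \<kappa> * min_entry N \<phi> * sin \<theta>s" if "\<alpha> \<in> {1..N}" "\<beta> \<in> {1..N}" for \<alpha> \<beta>
    proof -
      have "0 < min_entry N \<phi> * sin \<theta>s" using sin_pos min_entry_pos[OF N comm] by simp
      then have "diam N \<nu> < \<kappa> * (min_entry N \<phi> * sin \<theta>s)"
        using \<kappa>_large by (simp only: pos_divide_less_eq)
      then show ?thesis using diff_le_diam[OF that, of \<nu>] by (simp add: mult.assoc)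
    qed
    show "\<Theta> 0 \<alpha> - \<Theta> 0 \<beta> \<le> \<theta>s" if "\<alpha> \<in> {1..N}" "\<beta> \<in> {1..N}" for \<alpha> \<beta>
      using diff_le_diam[OF that, of \<Theta>0] diam init that by simp
  qed
  have "GK_flow F aG bG m M l \<kappa> a\<Phi> b\<Phi> \<theta>s N \<nu> \<phi> \<Theta> \<omega>"
    using comm N \<kappa> a\<Phi> \<theta>s \<phi> cont \<omega> velocity \<nu> phases
    by (intro GK_flow.intro[OF response] GK_flow_axioms.intro) (auto simp: comm_matrix_def)
  then show thesis by (rule that)
qed

theorem corollary3p1:
  fixes L :: ereal and F :: "real \<Rightarrow> real"
    and \<kappa> a\<Phi> b\<Phi> aG bG \<theta>s :: real
  assumes "0 < L"
    and "F C1_differentiable_on einterval (- L) L"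
    and "deriv F C1_differentiable_on einterval (- L) L"
    and "\<forall>\<theta>\<in>einterval (- L) L. F (- \<theta>) = - F \<theta>"
    and "\<forall>\<theta>\<in>einterval (- L) L. deriv F \<theta> > 0"
    and "\<kappa> > 0"
    and "b\<Phi> \<ge> a\<Phi>" and "a\<Phi> > 0"
    and "- L < ereal aG" and "aG < bG" and "ereal bG < L"
    and "0 < \<theta>s" and "\<theta>s < pi / 2"
  shows "\<exists>\<Lambda>3>0. \<forall>N\<ge>1.
    \<forall>(\<Theta>0 :: nat \<Rightarrow> real) (\<Theta>0' :: nat \<Rightarrow> real) (\<nu> :: nat \<Rightarrow> real) (\<nu>' :: nat \<Rightarrow> real)
      (\<phi> :: nat \<Rightarrow> nat \<Rightarrow> real) (\<phi>' :: nat \<Rightarrow> nat \<Rightarrow> real)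
      (\<Theta> :: real \<Rightarrow> nat \<Rightarrow> real) (\<Theta>' :: real \<Rightarrow> nat \<Rightarrow> real).
      comm_matrix N \<phi> \<longrightarrow> comm_matrix N \<phi>' \<longrightarrow>
      max (diam N \<Theta>0) (diam N \<Theta>0') \<le> \<theta>s \<longrightarrow>
      (\<forall>\<alpha>\<in>{1..N}. \<forall>\<beta>\<in>{1..N}. \<phi> \<alpha> \<beta> \<in> {a\<Phi>..b\<Phi>} \<and> \<phi>' \<alpha> \<beta> \<in> {a\<Phi>..b\<Phi>}) \<longrightarrow>
      \<kappa> > Max {diam N \<nu> / (min_entry N \<phi> * sin \<theta>s),
               diam N \<nu>' / (min_entry N \<phi>' * sin \<theta>s),
               M_Qinv F aG bG /
                 (max (min_entry N \<phi>) (min_entry N \<phi>') * (m_Gderiv L F aG bG)\<^sup>2 * cos \<theta>s)} \<longrightarrow>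
      (\<forall>\<alpha>\<in>{1..N}. \<nu> \<alpha> \<in> {F aG + \<kappa> * b\<Phi>..F bG - \<kappa> * b\<Phi>} \<and>
                   \<nu>' \<alpha> \<in> {F aG + \<kappa> * b\<Phi>..F bG - \<kappa> * b\<Phi>}) \<longrightarrow>
      (\<Sum>\<alpha>=1..N. \<nu> \<alpha>) = (\<Sum>\<alpha>=1..N. \<nu>' \<alpha>) \<longrightarrow>
      GK_solution L F \<kappa> N \<Theta>0 \<nu> \<phi> \<Theta> \<longrightarrow>
      GK_solution L F \<kappa> N \<Theta>0' \<nu>' \<phi>' \<Theta>' \<longrightarrow>
      (\<forall>p\<in>{1..\<infinity>}.
         (SUP t\<in>{0..}. ereal (vec_norm p N (\<lambda>\<alpha>. \<Theta> t \<alpha> - \<Theta>' t \<alpha>)))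
         \<le> ereal (\<Lambda>3 * (vec_norm p N (\<lambda>\<alpha>. \<Theta>0 \<alpha> - \<Theta>0' \<alpha>)
               + vec_norm p N (\<lambda>\<alpha>. \<nu> \<alpha> - \<nu>' \<alpha>)
               + mat_norm p N (\<lambda>\<alpha> \<beta>. \<phi> \<alpha> \<beta> - \<phi>' \<alpha> \<beta>)
                   / real N powr real_of_ereal (1 / p))))"
proof -
  let ?I = "einterval (- L) L"
  have "aG \<in> ?I" "bG \<in> ?I"
    using assms(9-11) less_trans[of "- L" "ereal aG" "ereal bG"] less_trans[of "ereal aG" "ereal bG" L]
    by (auto simp: einterval_def)
  note I = this
  obtain m M l where response: "velocity_response F aG bG m M l"
    using velocity_response_exists[OF assms(10) einterval_interval_subset[OF I] assms(2,3,5)] .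
  have mono: "strict_mono_on ?I F"
    by (rule strict_mono_on_einterval[OF assms(2,5)])
  have m: "0 < m" using response by (simp add: velocity_response_def)
  define r where "r = \<kappa> * a\<Phi> * cos \<theta>s"
  define b where "b = \<kappa> * b\<Phi>"
  define E where "E = exp (2 * b * (l * (M * (F bG - F aG))) / (r * m))"
  define K where "K = 1 + (1 + \<kappa>) * (1 / r + 1 / (2 * b))"
  have "0 < cos \<theta>s" using assms(12,13) by (intro cos_gt_zero_pi) auto
  then have rb: "0 < r" "0 < b" using assms(6-8) by (auto simp: r_def b_def)
  have E: "0 < E" by (simp add: E_def)
  have "0 < 1 / r + 1 / (2 * b)" using rb by (simp add: add_pos_pos)
  note s = this
  then have K: "1 \<le> K" "(1 + \<kappa>) * (1 / r + 1 / (2 * b)) \<le> K" using assms(6) by (auto simp: K_def)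
  show ?thesis
  proof (intro exI[of _ "K * E"] conjI allI impI ballI)
    show "0 < K * E" using K E by simp
    fix N :: nat and \<Theta>0 \<Theta>0' \<nu> \<nu>' :: "nat \<Rightarrow> real" and \<phi> \<phi>' :: "nat \<Rightarrow> nat \<Rightarrow> real"
      and \<Theta> \<Theta>' :: "real \<Rightarrow> nat \<Rightarrow> real" and p :: ereal
    assume N: "1 \<le> N" and comm: "comm_matrix N \<phi>" "comm_matrix N \<phi>'"
      and diam: "max (diam N \<Theta>0) (diam N \<Theta>0') \<le> \<theta>s"
      and \<phi>: "\<forall>\<alpha>\<in>{1..N}. \<forall>\<beta>\<in>{1..N}. \<phi> \<alpha> \<beta> \<in> {a\<Phi>..b\<Phi>} \<and> \<phi>' \<alpha> \<beta> \<in> {a\<Phi>..b\<Phi>}"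
      and \<kappa>_large: "\<kappa> > Max {diam N \<nu> / (min_entry N \<phi> * sin \<theta>s),
               diam N \<nu>' / (min_entry N \<phi>' * sin \<theta>s),
               M_Qinv F aG bG /
                 (max (min_entry N \<phi>) (min_entry N \<phi>') * (m_Gderiv L F aG bG)\<^sup>2 * cos \<theta>s)}"
      and \<nu>: "\<forall>\<alpha>\<in>{1..N}. \<nu> \<alpha> \<in> {F aG + \<kappa> * b\<Phi>..F bG - \<kappa> * b\<Phi>} \<and>
                   \<nu>' \<alpha> \<in> {F aG + \<kappa> * b\<Phi>..F bG - \<kappa> * b\<Phi>}"
      and same_mean: "(\<Sum>\<alpha>=1..N. \<nu> \<alpha>) = (\<Sum>\<alpha>=1..N. \<nu>' \<alpha>)"
      and sol: "GK_solution L F \<kappa> N \<Theta>0 \<nu> \<phi> \<Theta>" "GK_solution L F \<kappa> N \<Theta>0' \<nu>' \<phi>' \<Theta>'"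
      and "p \<in> {1..\<infinity>}"
    then have p: "1 \<le> p" by simp
    obtain \<omega> where flow: "GK_flow F aG bG m M l \<kappa> a\<Phi> b\<Phi> \<theta>s N \<nu> \<phi> \<Theta> \<omega>"
      by (rule GK_solution_is_flow[OF response mono I N assms(6,8,12,13) comm(1) _ _ _ _ sol(1)])
        (use \<phi> diam \<kappa>_large \<nu> in auto)
    obtain \<omega>' where flow': "GK_flow F aG bG m M l \<kappa> a\<Phi> b\<Phi> \<theta>s N \<nu>' \<phi>' \<Theta>' \<omega>'"
      by (rule GK_solution_is_flow[OF response mono I N assms(6,8,12,13) comm(2) _ _ _ _ sol(2)])
        (use \<phi> diam \<kappa>_large \<nu> in auto)
    define X where "X = vec_norm p N (\<lambda>\<alpha>. \<Theta>0 \<alpha> - \<Theta>0' \<alpha>)"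
    define Y where "Y = vec_norm p N (\<lambda>\<alpha>. \<nu> \<alpha> - \<nu>' \<alpha>)"
    define Z where "Z = mat_norm p N (\<lambda>\<alpha> \<beta>. \<phi> \<alpha> \<beta> - \<phi>' \<alpha> \<beta>) / real N powr real_of_ereal (1 / p)"
    have init: "vec_norm p N (\<lambda>\<alpha>. \<Theta> 0 \<alpha> - \<Theta>' 0 \<alpha>) = X"
      unfolding X_def using sol by (intro vec_norm_cong_abs[OF p N]) (auto simp: GK_solution_def)
    have XY: "0 \<le> X" "0 \<le> Y" unfolding X_def Y_def by (intro vec_norm_nonneg[OF N])+
    have Z: "0 \<le> Z"
      unfolding Z_def by (rule order_trans[OF vec_norm_nonneg[OF N] vec_norm_row_average[OF p N]])
    have "vec_norm p N (\<lambda>\<alpha>. \<Theta> t \<alpha> - \<Theta>' t \<alpha>) \<le> K * E * (X + Y + Z)" if t: "0 \<le> t" for t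
    proof -
      have "vec_norm p N (\<lambda>\<alpha>. \<Theta> t \<alpha> - \<Theta>' t \<alpha>)
          \<le> (X + (Y + \<kappa> * Z) / r + (Y + \<kappa> * Z) / (2 * b)) * E"
        using GK_flows_stability[OF flow flow' same_mean assms(10) p t]
        unfolding init E_def r_def b_def Y_def Z_def .
      also have "X + (Y + \<kappa> * Z) / r + (Y + \<kappa> * Z) / (2 * b)
          = X + (Y + \<kappa> * Z) * (1 / r + 1 / (2 * b))" by (simp add: algebra_simps add_divide_distrib)
      also have "\<dots> \<le> X + (1 + \<kappa>) * (Y + Z) * (1 / r + 1 / (2 * b))"
        using s assms(6) XY Z by (intro add_left_mono mult_right_mono) (auto simp: algebra_simps)
      also have "\<dots> = 1 * X + ((1 + \<kappa>) * (1 / r + 1 / (2 * b))) * (Y + Z)" by (simp add: mult_ac)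
      also have "\<dots> \<le> K * X + K * (Y + Z)"
        using K XY Z by (intro add_mono mult_right_mono) auto
      finally show ?thesis using E by (simp add: algebra_simps)
    qed
    then show "(SUP t\<in>{0..}. ereal (vec_norm p N (\<lambda>\<alpha>. \<Theta> t \<alpha> - \<Theta>' t \<alpha>)))
         \<le> ereal (K * E * (vec_norm p N (\<lambda>\<alpha>. \<Theta>0 \<alpha> - \<Theta>0' \<alpha>)
               + vec_norm p N (\<lambda>\<alpha>. \<nu> \<alpha> - \<nu>' \<alpha>)
               + mat_norm p N (\<lambda>\<alpha> \<beta>. \<phi> \<alpha> \<beta> - \<phi>' \<alpha> \<beta>)
                   / real N powr real_of_ereal (1 / p)))"
      unfolding X_def Y_def Z_def by (intro SUP_least) auto
  qed
qed

end
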